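(* There is an isomorphism between the $2$-category of monoidal categories with LR units, strong monoidal functors in the LR sense, and monoidal natural transformations, and the $2$-category of monoidal categories with Saavedra units, strong monoidal functors in the Saavedra-unit sense, and monoidal natural transformations.
   Context: A semi-monoidal category is a category with a strictly associative functor $\mathscr{C}\times\mathscr{C}\to\mathscr{C}$, written as juxtaposition. The identity arrow of an object $X$ is also written $X$. An LR unit is a triple $(I,\lambda,\rho)$ with $\lambda_X: IX\to X$, $\rho_X: XI\to X$ natural isomorphisms satisfying, for all $X,Y$: $\lambda_I=\rho_I$; $\lambda_{XY}=\lambda_X Y$; $\rho_{XY}=X\rho_Y$; $X\lambda_Y=\rho_X Y$. A Saavedra unit is a pair $(I,\alpha)$ where $\alpha:II\to I$ is an isomorphism and $I$ is cancellable, meaning that the functors $X\mapsto IX$ and $X\mapsto XI$ are fully faithful. A monoidal category with LR (resp. Saavedra) unit is a semi-monoidal category with a chosen LR (resp. Saavedra) unit. A strong multiplicative functor $(F,\phi_2)$ is a functor $F$ with natural isomorphisms $\phi_{X,Y}:F(X)F(Y)\to F(XY)$ such that $\phi_{XY,Z}\circ(\phi_{X,Y}F(Z))=\phi_{X,YZ}\circ(F(X)\phi_{Y,Z})$. A strong monoidal functor in the LR sense from $\mathscr{C}$ with unit $(I,\lambda^I,\rho^I)$ to $\mathscr{D}$ with unit $(J,\lambda^J,\rho^J)$ is a strong multiplicative functor $(F,\phi_2)$ with an isomorphism $\phi_0:J\to F(I)$ such that for all $X$: $\lambda^J_{F(X)}=F(\lambda^I_X)\circ\phi_{I,X}\circ(\phi_0F(X))$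 and $\rho^J_{F(X)}=F(\rho^I_X)\circ\phi_{X,I}\circ(F(X)\phi_0)$. A strong monoidal functor in the Saavedra-unit sense from $\mathscr{C}$ with unit $(I,\alpha)$ to $\mathscr{D}$ with unit $(J,\beta)$ is a strong multiplicative functor $(F,\phi_2)$ with an isomorphism $\phi_0:J\to F(I)$ such that $\phi_0\circ\beta=F(\alpha)\circ\phi_{I,I}\circ(\phi_0\phi_0)$. A natural transformation $u:F\Rightarrow G$ between strong multiplicative functors $(F,\phi_2)$, $(G,\gamma_2)$ is multiplicative if $u_{XY}\circ\phi_{X,Y}=\gamma_{X,Y}\circ(u_Xu_Y)$ for all $X,Y$. When $F$ and $G$ are strong monoidal with unit compatibilities $\phi_0,\gamma_0$ (in either sense), a multiplicative $u$ is monoidal if $u_I\circ\phi_0=\gamma_0$. *)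

theory Defs
  imports "HOL-Library.FuncSet"
begin

section \<open>Categories, functors, natural transformations\<close>

record ('o, 'm) cat =
  Obj :: "'o set"
  Arr :: "'m set"
  Dom :: "'m \<Rightarrow> 'o"
  Cod :: "'m \<Rightarrow> 'o"
  Ide :: "'o \<Rightarrow> 'm"
  Comp :: "'m \<Rightarrow> 'm \<Rightarrow> 'm"  (infixr "\<cdot>\<index>" 55)

definition hom :: "('o, 'm, 'z) cat_scheme \<Rightarrow> 'o \<Rightarrow> 'o \<Rightarrow> 'm set"
  where "hom C X Y = {f \<in> Arr C. Dom C f = X \<and> Cod C f = Y}"

locale category =
  fixes C :: "('o, 'm, 'z) cat_scheme" (structure)
  assumes Dom_closed: "f \<in> Arr C \<Longrightarrow> Dom C f \<in> Obj C"
    and Cod_closed: "f \<in> Arr C \<Longrightarrow> Cod C f \<in> Obj C"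
    and Ide_hom: "X \<in> Obj C \<Longrightarrow> Ide C X \<in> hom C X X"
    and Comp_hom: "\<lbrakk>f \<in> hom C X Y; g \<in> hom C Y Z\<rbrakk> \<Longrightarrow> g \<cdot> f \<in> hom C X Z"
    and Comp_Ide_left: "f \<in> hom C X Y \<Longrightarrow> Ide C Y \<cdot> f = f"
    and Comp_Ide_right: "f \<in> hom C X Y \<Longrightarrow> f \<cdot> Ide C X = f"
    and Comp_assoc: "\<lbrakk>f \<in> hom C W X; g \<in> hom C X Y; h \<in> hom C Y Z\<rbrakk>
      \<Longrightarrow> (h \<cdot> g) \<cdot> f = h \<cdot> (g \<cdot> f)"

text \<open>
  The operations of a record are total HOL functions.  Wherever equality of structures matters
  (objects, 1-cells and 2-cells of the 2-categories below), they are required to be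
  \<^const>\<open>undefined\<close> outside their mathematical domain, so that HOL equality is equality of the
  mathematical structures.
\<close>

definition extensional_cat :: "('o, 'm, 'z) cat_scheme \<Rightarrow> bool"
  where "extensional_cat C \<longleftrightarrow>
    Dom C \<in> extensional (Arr C) \<and> Cod C \<in> extensional (Arr C) \<and> Ide C \<in> extensional (Obj C) \<and>
    (\<forall>g f. \<not> (f \<in> Arr C \<and> g \<in> Arr C \<and> Cod C f = Dom C g) \<longrightarrow> g \<cdot>\<^bsub>C\<^esub> f = undefined)"

definition iso_arr :: "('o, 'm, 'z) cat_scheme \<Rightarrow> 'o \<Rightarrow> 'o \<Rightarrow> 'm \<Rightarrow> bool"
  where "iso_arr C X Y f \<longleftrightarrow> f \<in> hom C X Y \<and>
    (\<exists>g \<in> hom C Y X. g \<cdot>\<^bsub>C\<^esub> f = Ide C X \<and> f \<cdot>\<^bsub>C\<^esub> g = Ide C Y)"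

definition prod_cat ::
  "('o, 'm, 'y) cat_scheme \<Rightarrow> ('p, 'n, 'z) cat_scheme \<Rightarrow> ('o \<times> 'p, 'm \<times> 'n) cat"
  where "prod_cat C D =
    \<lparr>Obj = Obj C \<times> Obj D,
     Arr = Arr C \<times> Arr D,
     Dom = map_prod (Dom C) (Dom D),
     Cod = map_prod (Cod C) (Cod D),
     Ide = map_prod (Ide C) (Ide D),
     Comp = (\<lambda>g f. (fst g \<cdot>\<^bsub>C\<^esub> fst f, snd g \<cdot>\<^bsub>D\<^esub> snd f))\<rparr>"

record ('o, 'm, 'p, 'n) functor_data =
  obj_map :: "'o \<Rightarrow> 'p"
  arr_map :: "'m \<Rightarrow> 'n"

locale cat_functor = C: category C + D: category D
  for C :: "('o, 'm, 'y) cat_scheme" and D :: "('p, 'n, 'z) cat_scheme" +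
  fixes F :: "('o, 'm, 'p, 'n, 'w) functor_data_scheme"
  assumes obj_map_closed: "X \<in> Obj C \<Longrightarrow> obj_map F X \<in> Obj D"
    and arr_map_hom: "f \<in> hom C X Y \<Longrightarrow> arr_map F f \<in> hom D (obj_map F X) (obj_map F Y)"
    and arr_map_Ide: "X \<in> Obj C \<Longrightarrow> arr_map F (Ide C X) = Ide D (obj_map F X)"
    and arr_map_Comp: "\<lbrakk>f \<in> hom C X Y; g \<in> hom C Y Z\<rbrakk>
      \<Longrightarrow> arr_map F (g \<cdot>\<^bsub>C\<^esub> f) = arr_map F g \<cdot>\<^bsub>D\<^esub> arr_map F f"

definition extensional_functor ::
  "('o, 'm, 'y) cat_scheme \<Rightarrow> ('o, 'm, 'p, 'n, 'w) functor_data_scheme \<Rightarrow> bool"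
  where "extensional_functor C F \<longleftrightarrow>
    obj_map F \<in> extensional (Obj C) \<and> arr_map F \<in> extensional (Arr C)"

definition id_functor :: "('o, 'm, 'y) cat_scheme \<Rightarrow> ('o, 'm, 'o, 'm) functor_data"
  where "id_functor C = \<lparr>obj_map = (\<lambda>X\<in>Obj C. X), arr_map = (\<lambda>f\<in>Arr C. f)\<rparr>"

definition comp_functor ::
  "('o, 'm, 'y) cat_scheme \<Rightarrow> ('p, 'n, 'q, 'k, 'w) functor_data_scheme
    \<Rightarrow> ('o, 'm, 'p, 'n, 'v) functor_data_scheme \<Rightarrow> ('o, 'm, 'q, 'k) functor_data"
  where "comp_functor C G F =
    \<lparr>obj_map = (\<lambda>X\<in>Obj C. obj_map G (obj_map F X)),
     arr_map = (\<lambda>f\<in>Arr C. arr_map G (arr_map F f))\<rparr>"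

definition prod_functor ::
  "('o, 'm, 'p, 'n, 'v) functor_data_scheme \<Rightarrow> ('o1, 'm1, 'p1, 'n1, 'w) functor_data_scheme
    \<Rightarrow> ('o \<times> 'o1, 'm \<times> 'm1, 'p \<times> 'p1, 'n \<times> 'n1) functor_data"
  where "prod_functor F G =
    \<lparr>obj_map = map_prod (obj_map F) (obj_map G), arr_map = map_prod (arr_map F) (arr_map G)\<rparr>"

definition fully_faithful ::
  "('o, 'm, 'y) cat_scheme \<Rightarrow> ('p, 'n, 'z) cat_scheme
    \<Rightarrow> ('o, 'm, 'p, 'n, 'w) functor_data_scheme \<Rightarrow> bool"
  where "fully_faithful C D F \<longleftrightarrow> cat_functor C D F \<and>
    (\<forall>X\<in>Obj C. \<forall>Y\<in>Obj C.
      bij_betw (arr_map F) (hom C X Y) (hom D (obj_map F X) (obj_map F Y)))"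

locale nat_transf = F: cat_functor C D F + G: cat_functor C D G
  for C :: "('o, 'm, 'y) cat_scheme" and D :: "('p, 'n, 'z) cat_scheme"
    and F :: "('o, 'm, 'p, 'n, 'v) functor_data_scheme"
    and G :: "('o, 'm, 'p, 'n, 'w) functor_data_scheme" +
  fixes u :: "'o \<Rightarrow> 'n"
  assumes component_hom: "X \<in> Obj C \<Longrightarrow> u X \<in> hom D (obj_map F X) (obj_map G X)"
    and naturality: "f \<in> hom C X Y \<Longrightarrow> u Y \<cdot>\<^bsub>D\<^esub> arr_map F f = arr_map G f \<cdot>\<^bsub>D\<^esub> u X"

locale nat_iso = nat_transf +
  assumes component_iso: "X \<in> Obj C \<Longrightarrow> iso_arr D (obj_map F X) (obj_map G X) (u X)"


section \<open>2-categories, 2-functors and isomorphisms of 2-categories\<close>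

text \<open>
  A (strict) 2-category is a category enriched in categories: for each pair of objects a category
  of 1-cells and 2-cells, identity 1-cells, and composition functors
  \<open>HComp X A B C : Hom(B, C) \<times> Hom(A, B) \<rightarrow> Hom(A, C)\<close>, strictly associative and unital.
\<close>

record ('a, 'f, 't) two_cat =
  Cell0 :: "'a set"
  HomCat :: "'a \<Rightarrow> 'a \<Rightarrow> ('f, 't) cat"
  Id1 :: "'a \<Rightarrow> 'f"
  HComp :: "'a \<Rightarrow> 'a \<Rightarrow> 'a \<Rightarrow> ('f \<times> 'f, 't \<times> 't, 'f, 't) functor_data"

abbreviation hcomp1 :: "('a, 'f, 't) two_cat \<Rightarrow> 'a \<Rightarrow> 'a \<Rightarrow> 'a \<Rightarrow> 'f \<Rightarrow> 'f \<Rightarrow> 'f"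
  where "hcomp1 X A B C g f \<equiv> obj_map (HComp X A B C) (g, f)"

abbreviation hcomp2 :: "('a, 'f, 't) two_cat \<Rightarrow> 'a \<Rightarrow> 'a \<Rightarrow> 'a \<Rightarrow> 't \<Rightarrow> 't \<Rightarrow> 't"
  where "hcomp2 X A B C v u \<equiv> arr_map (HComp X A B C) (v, u)"

abbreviation id2 :: "('a, 'f, 't) two_cat \<Rightarrow> 'a \<Rightarrow> 't"
  where "id2 X A \<equiv> Ide (HomCat X A A) (Id1 X A)"

locale two_category =
  fixes X :: "('a, 'f, 't) two_cat"
  assumes HomCat_category: "\<lbrakk>A \<in> Cell0 X; B \<in> Cell0 X\<rbrakk> \<Longrightarrow> category (HomCat X A B)"
    and Id1_closed: "A \<in> Cell0 X \<Longrightarrow> Id1 X A \<in> Obj (HomCat X A A)"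
    and HComp_functor: "\<lbrakk>A \<in> Cell0 X; B \<in> Cell0 X; C \<in> Cell0 X\<rbrakk>
      \<Longrightarrow> cat_functor (prod_cat (HomCat X B C) (HomCat X A B)) (HomCat X A C) (HComp X A B C)"
    and hcomp1_assoc:
      "\<lbrakk>A \<in> Cell0 X; B \<in> Cell0 X; C \<in> Cell0 X; D \<in> Cell0 X;
        f \<in> Obj (HomCat X A B); g \<in> Obj (HomCat X B C); h \<in> Obj (HomCat X C D)\<rbrakk>
      \<Longrightarrow> hcomp1 X A B D (hcomp1 X B C D h g) f = hcomp1 X A C D h (hcomp1 X A B C g f)"
    and hcomp2_assoc:
      "\<lbrakk>A \<in> Cell0 X; B \<in> Cell0 X; C \<in> Cell0 X; D \<in> Cell0 X;
        u \<in> Arr (HomCat X A B); v \<in> Arr (HomCat X B C); w \<in> Arr (HomCat X C D)\<rbrakk>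
      \<Longrightarrow> hcomp2 X A B D (hcomp2 X B C D w v) u = hcomp2 X A C D w (hcomp2 X A B C v u)"
    and hcomp1_Id1_left: "\<lbrakk>A \<in> Cell0 X; B \<in> Cell0 X; f \<in> Obj (HomCat X A B)\<rbrakk>
      \<Longrightarrow> hcomp1 X A B B (Id1 X B) f = f"
    and hcomp1_Id1_right: "\<lbrakk>A \<in> Cell0 X; B \<in> Cell0 X; f \<in> Obj (HomCat X A B)\<rbrakk>
      \<Longrightarrow> hcomp1 X A A B f (Id1 X A) = f"
    and hcomp2_id2_left: "\<lbrakk>A \<in> Cell0 X; B \<in> Cell0 X; u \<in> Arr (HomCat X A B)\<rbrakk>
      \<Longrightarrow> hcomp2 X A B B (id2 X B) u = u"
    and hcomp2_id2_right: "\<lbrakk>A \<in> Cell0 X; B \<in> Cell0 X; u \<in> Arr (HomCat X A B)\<rbrakk>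
      \<Longrightarrow> hcomp2 X A A B u (id2 X A) = u"

record ('a, 'f, 't, 'b, 'g, 's) two_functor_data =
  map0 :: "'a \<Rightarrow> 'b"
  map_hom :: "'a \<Rightarrow> 'a \<Rightarrow> ('f, 't, 'g, 's) functor_data"

locale two_functor = X: two_category X + Y: two_category Y
  for X :: "('a, 'f, 't) two_cat" and Y :: "('b, 'g, 's) two_cat" +
  fixes \<Phi> :: "('a, 'f, 't, 'b, 'g, 's) two_functor_data"
  assumes map0_closed: "A \<in> Cell0 X \<Longrightarrow> map0 \<Phi> A \<in> Cell0 Y"
    and map_hom_functor: "\<lbrakk>A \<in> Cell0 X; B \<in> Cell0 X\<rbrakk>
      \<Longrightarrow> cat_functor (HomCat X A B) (HomCat Y (map0 \<Phi> A) (map0 \<Phi> B)) (map_hom \<Phi> A B)"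
    and map_hom_Id1: "A \<in> Cell0 X \<Longrightarrow> obj_map (map_hom \<Phi> A A) (Id1 X A) = Id1 Y (map0 \<Phi> A)"
    and map_hom_hcomp1:
      "\<lbrakk>A \<in> Cell0 X; B \<in> Cell0 X; C \<in> Cell0 X;
        f \<in> Obj (HomCat X A B); g \<in> Obj (HomCat X B C)\<rbrakk>
      \<Longrightarrow> obj_map (map_hom \<Phi> A C) (hcomp1 X A B C g f) =
          hcomp1 Y (map0 \<Phi> A) (map0 \<Phi> B) (map0 \<Phi> C)
            (obj_map (map_hom \<Phi> B C) g) (obj_map (map_hom \<Phi> A B) f)"
    and map_hom_hcomp2:
      "\<lbrakk>A \<in> Cell0 X; B \<in> Cell0 X; C \<in> Cell0 X;
        u \<in> Arr (HomCat X A B); v \<in> Arr (HomCat X B C)\<rbrakk>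
      \<Longrightarrow> arr_map (map_hom \<Phi> A C) (hcomp2 X A B C v u) =
          hcomp2 Y (map0 \<Phi> A) (map0 \<Phi> B) (map0 \<Phi> C)
            (arr_map (map_hom \<Phi> B C) v) (arr_map (map_hom \<Phi> A B) u)"

text \<open>\<open>\<Psi> \<circ> \<Phi>\<close> is the identity 2-functor, on 0-cells, 1-cells and 2-cells.\<close>

definition left_inverse_two_functor ::
  "('a, 'f, 't) two_cat \<Rightarrow> ('a, 'f, 't, 'b, 'g, 's) two_functor_data
    \<Rightarrow> ('b, 'g, 's, 'a, 'f, 't) two_functor_data \<Rightarrow> bool"
  where "left_inverse_two_functor X \<Phi> \<Psi> \<longleftrightarrow>
    (\<forall>A\<in>Cell0 X. map0 \<Psi> (map0 \<Phi> A) = A) \<and>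
    (\<forall>A\<in>Cell0 X. \<forall>B\<in>Cell0 X.
      (\<forall>f\<in>Obj (HomCat X A B).
        obj_map (map_hom \<Psi> (map0 \<Phi> A) (map0 \<Phi> B)) (obj_map (map_hom \<Phi> A B) f) = f) \<and>
      (\<forall>u\<in>Arr (HomCat X A B).
        arr_map (map_hom \<Psi> (map0 \<Phi> A) (map0 \<Phi> B)) (arr_map (map_hom \<Phi> A B) u) = u))"

definition two_cat_isomorphism ::
  "('a, 'f, 't) two_cat \<Rightarrow> ('b, 'g, 's) two_cat
    \<Rightarrow> ('a, 'f, 't, 'b, 'g, 's) two_functor_data \<Rightarrow> bool"
  where "two_cat_isomorphism X Y \<Phi> \<longleftrightarrow> two_functor X Y \<Phi> \<and>
    (\<exists>\<Psi>. two_functor Y X \<Psi> \<and>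
      left_inverse_two_functor X \<Phi> \<Psi> \<and> left_inverse_two_functor Y \<Psi> \<Phi>)"


section \<open>Semi-monoidal categories and units\<close>

record ('o, 'm) semimon_cat = "('o, 'm) cat" +
  Tens :: "('o \<times> 'o, 'm \<times> 'm, 'o, 'm) functor_data"

abbreviation tens_obj :: "('o, 'm, 'z) semimon_cat_scheme \<Rightarrow> 'o \<Rightarrow> 'o \<Rightarrow> 'o"
    (infixl "\<odot>\<index>" 70)
  where "X \<odot>\<^bsub>C\<^esub> Y \<equiv> obj_map (Tens C) (X, Y)"

abbreviation tens_arr :: "('o, 'm, 'z) semimon_cat_scheme \<Rightarrow> 'm \<Rightarrow> 'm \<Rightarrow> 'm"
    (infixl "\<otimes>\<index>" 70)
  where "f \<otimes>\<^bsub>C\<^esub> g \<equiv> arr_map (Tens C) (f, g)"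

locale semimonoidal = category C
  for C :: "('o, 'm, 'z) semimon_cat_scheme" (structure) +
  assumes ext_cat: "extensional_cat C"
    and Tens_functor: "cat_functor (prod_cat C C) C (Tens C)"
    and Tens_ext: "extensional_functor (prod_cat C C) (Tens C)"
    and tens_obj_assoc: "\<lbrakk>X \<in> Obj C; Y \<in> Obj C; Z \<in> Obj C\<rbrakk>
      \<Longrightarrow> (X \<odot> Y) \<odot> Z = X \<odot> (Y \<odot> Z)"
    and tens_arr_assoc: "\<lbrakk>f \<in> Arr C; g \<in> Arr C; h \<in> Arr C\<rbrakk>
      \<Longrightarrow> (f \<otimes> g) \<otimes> h = f \<otimes> (g \<otimes> h)"

text \<open>The functors \<open>X \<mapsto> IX\<close> and \<open>X \<mapsto> XI\<close>.\<close>

definition tens_left ::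
  "('o, 'm, 'z) semimon_cat_scheme \<Rightarrow> 'o \<Rightarrow> ('o, 'm, 'o, 'm) functor_data"
  where "tens_left C I =
    \<lparr>obj_map = (\<lambda>X. I \<odot>\<^bsub>C\<^esub> X), arr_map = (\<lambda>f. Ide C I \<otimes>\<^bsub>C\<^esub> f)\<rparr>"

definition tens_right ::
  "('o, 'm, 'z) semimon_cat_scheme \<Rightarrow> 'o \<Rightarrow> ('o, 'm, 'o, 'm) functor_data"
  where "tens_right C I =
    \<lparr>obj_map = (\<lambda>X. X \<odot>\<^bsub>C\<^esub> I), arr_map = (\<lambda>f. f \<otimes>\<^bsub>C\<^esub> Ide C I)\<rparr>"

locale lr_unit = semimonoidal C
  for C :: "('o, 'm, 'z) semimon_cat_scheme" (structure) +
  fixes I :: 'o and l :: "'o \<Rightarrow> 'm" and r :: "'o \<Rightarrow> 'm"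
  assumes lr_unit_obj: "I \<in> Obj C"
    and l_nat_iso: "nat_iso C C (tens_left C I) (id_functor C) l"
    and r_nat_iso: "nat_iso C C (tens_right C I) (id_functor C) r"
    and l_I_eq_r_I: "l I = r I"
    and l_tens: "\<lbrakk>X \<in> Obj C; Y \<in> Obj C\<rbrakk> \<Longrightarrow> l (X \<odot> Y) = l X \<otimes> Ide C Y"
    and r_tens: "\<lbrakk>X \<in> Obj C; Y \<in> Obj C\<rbrakk> \<Longrightarrow> r (X \<odot> Y) = Ide C X \<otimes> r Y"
    and middle: "\<lbrakk>X \<in> Obj C; Y \<in> Obj C\<rbrakk> \<Longrightarrow> Ide C X \<otimes> l Y = r X \<otimes> Ide C Y"

definition cancellable :: "('o, 'm, 'z) semimon_cat_scheme \<Rightarrow> 'o \<Rightarrow> bool"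
  where "cancellable C I \<longleftrightarrow> I \<in> Obj C \<and>
    fully_faithful C C (tens_left C I) \<and> fully_faithful C C (tens_right C I)"

locale saavedra_unit = semimonoidal C
  for C :: "('o, 'm, 'z) semimon_cat_scheme" (structure) +
  fixes I :: 'o and a :: 'm
  assumes unit_cancellable: "cancellable C I"
    and a_iso: "iso_arr C (I \<odot> I) I a"

record ('o, 'm) unital_cat = "('o, 'm) semimon_cat" +
  Unit :: 'o

record ('o, 'm) lr_cat = "('o, 'm) unital_cat" +
  Lam :: "'o \<Rightarrow> 'm"
  Rho :: "'o \<Rightarrow> 'm"

record ('o, 'm) saavedra_cat = "('o, 'm) unital_cat" +
  Alpha :: 'm

definition lr_monoidal :: "('o, 'm) lr_cat \<Rightarrow> bool"
  where "lr_monoidal C \<longleftrightarrow> lr_unit C (Unit C) (Lam C) (Rho C) \<and>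
    Lam C \<in> extensional (Obj C) \<and> Rho C \<in> extensional (Obj C)"

definition saavedra_monoidal :: "('o, 'm) saavedra_cat \<Rightarrow> bool"
  where "saavedra_monoidal C \<longleftrightarrow> saavedra_unit C (Unit C) (Alpha C)"


section \<open>Strong monoidal functors and monoidal transformations\<close>

record ('o, 'm, 'p, 'n) mult_functor = "('o, 'm, 'p, 'n) functor_data" +
  Phi2 :: "'o \<times> 'o \<Rightarrow> 'n"

record ('o, 'm, 'p, 'n) mon_functor = "('o, 'm, 'p, 'n) mult_functor" +
  Phi0 :: 'n

locale strong_multiplicative = cat_functor C D F
  for C :: "('o, 'm, 'y) semimon_cat_scheme" and D :: "('p, 'n, 'z) semimon_cat_scheme"
    and F :: "('o, 'm, 'p, 'n, 'w) mult_functor_scheme" +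
  assumes functor_ext: "extensional_functor C F"
    and Phi2_ext: "Phi2 F \<in> extensional (Obj C \<times> Obj C)"
    and Phi2_nat_iso: "nat_iso (prod_cat C C) D
      (comp_functor (prod_cat C C) (Tens D) (prod_functor F F))
      (comp_functor (prod_cat C C) F (Tens C))
      (Phi2 F)"
    and Phi2_assoc: "\<lbrakk>X \<in> Obj C; Y \<in> Obj C; Z \<in> Obj C\<rbrakk> \<Longrightarrow>
      Phi2 F (X \<odot>\<^bsub>C\<^esub> Y, Z) \<cdot>\<^bsub>D\<^esub> (Phi2 F (X, Y) \<otimes>\<^bsub>D\<^esub> Ide D (obj_map F Z)) =
      Phi2 F (X, Y \<odot>\<^bsub>C\<^esub> Z) \<cdot>\<^bsub>D\<^esub> (Ide D (obj_map F X) \<otimes>\<^bsub>D\<^esub> Phi2 F (Y, Z))"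

locale lr_strong_monoidal = strong_multiplicative C D F
  for C :: "('o, 'm) lr_cat" and D :: "('p, 'n) lr_cat"
    and F :: "('o, 'm, 'p, 'n) mon_functor" +
  assumes Phi0_iso: "iso_arr D (Unit D) (obj_map F (Unit C)) (Phi0 F)"
    and Phi0_Lam: "X \<in> Obj C \<Longrightarrow>
      Lam D (obj_map F X) = arr_map F (Lam C X) \<cdot>\<^bsub>D\<^esub>
        (Phi2 F (Unit C, X) \<cdot>\<^bsub>D\<^esub> (Phi0 F \<otimes>\<^bsub>D\<^esub> Ide D (obj_map F X)))"
    and Phi0_Rho: "X \<in> Obj C \<Longrightarrow>
      Rho D (obj_map F X) = arr_map F (Rho C X) \<cdot>\<^bsub>D\<^esub>
        (Phi2 F (X, Unit C) \<cdot>\<^bsub>D\<^esub> (Ide D (obj_map F X) \<otimes>\<^bsub>D\<^esub> Phi0 F))"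

locale saavedra_strong_monoidal = strong_multiplicative C D F
  for C :: "('o, 'm) saavedra_cat" and D :: "('p, 'n) saavedra_cat"
    and F :: "('o, 'm, 'p, 'n) mon_functor" +
  assumes Phi0_iso: "iso_arr D (Unit D) (obj_map F (Unit C)) (Phi0 F)"
    and Phi0_Alpha: "Phi0 F \<cdot>\<^bsub>D\<^esub> Alpha D =
      arr_map F (Alpha C) \<cdot>\<^bsub>D\<^esub> (Phi2 F (Unit C, Unit C) \<cdot>\<^bsub>D\<^esub> (Phi0 F \<otimes>\<^bsub>D\<^esub> Phi0 F))"

locale multiplicative_transf = nat_transf C D F G u
  for C :: "('o, 'm, 'y) semimon_cat_scheme" and D :: "('p, 'n, 'z) semimon_cat_scheme"
    and F :: "('o, 'm, 'p, 'n, 'v) mult_functor_scheme"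
    and G :: "('o, 'm, 'p, 'n, 'w) mult_functor_scheme"
    and u :: "'o \<Rightarrow> 'n" +
  assumes multiplicative: "\<lbrakk>X \<in> Obj C; Y \<in> Obj C\<rbrakk> \<Longrightarrow>
    u (X \<odot>\<^bsub>C\<^esub> Y) \<cdot>\<^bsub>D\<^esub> Phi2 F (X, Y) = Phi2 G (X, Y) \<cdot>\<^bsub>D\<^esub> (u X \<otimes>\<^bsub>D\<^esub> u Y)"

locale monoidal_transf = multiplicative_transf C D F G u
  for C :: "('o, 'm, 'y) unital_cat_scheme" and D :: "('p, 'n, 'z) unital_cat_scheme"
    and F :: "('o, 'm, 'p, 'n) mon_functor" and G :: "('o, 'm, 'p, 'n) mon_functor"
    and u :: "'o \<Rightarrow> 'n" +
  assumes unit_compatible: "u (Unit C) \<cdot>\<^bsub>D\<^esub> Phi0 F = Phi0 G"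


section \<open>The two 2-categories\<close>

text \<open>
  A 2-cell carries its source and target functors.  The categories of the 2-categories have their
  objects in the type \<open>'o\<close> and their arrows in the type \<open>'m\<close>; these two (arbitrary) types play the
  role of the universe of small categories.
\<close>

record ('o, 'm, 'p, 'n) transf =
  Src :: "('o, 'm, 'p, 'n) mon_functor"
  Tgt :: "('o, 'm, 'p, 'n) mon_functor"
  Cmp :: "'o \<Rightarrow> 'n"

definition id_mon_functor ::
  "('o, 'm, 'z) unital_cat_scheme \<Rightarrow> ('o, 'm, 'o, 'm) mon_functor"
  where "id_mon_functor C = functor_data.extend (id_functor C)
    \<lparr>Phi2 = (\<lambda>(X, Y)\<in>Obj C \<times> Obj C. Ide C (X \<odot>\<^bsub>C\<^esub> Y)),
     Phi0 = Ide C (Unit C)\<rparr>"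

definition comp_mon_functor ::
  "('o, 'm, 'x) unital_cat_scheme \<Rightarrow> ('q, 'k, 'z) unital_cat_scheme
    \<Rightarrow> ('p, 'n, 'q, 'k) mon_functor \<Rightarrow> ('o, 'm, 'p, 'n) mon_functor
    \<Rightarrow> ('o, 'm, 'q, 'k) mon_functor"
  where "comp_mon_functor C E G F = functor_data.extend (comp_functor C G F)
    \<lparr>Phi2 = (\<lambda>(X, Y)\<in>Obj C \<times> Obj C.
       arr_map G (Phi2 F (X, Y)) \<cdot>\<^bsub>E\<^esub> Phi2 G (obj_map F X, obj_map F Y)),
     Phi0 = arr_map G (Phi0 F) \<cdot>\<^bsub>E\<^esub> Phi0 G\<rparr>"

definition id_transf ::
  "('o, 'm, 'y) cat_scheme \<Rightarrow> ('p, 'n, 'z) cat_scheme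
    \<Rightarrow> ('o, 'm, 'p, 'n) mon_functor \<Rightarrow> ('o, 'm, 'p, 'n) transf"
  where "id_transf C D F =
    \<lparr>Src = F, Tgt = F, Cmp = (\<lambda>X\<in>Obj C. Ide D (obj_map F X))\<rparr>"

definition vcomp_transf ::
  "('o, 'm, 'y) cat_scheme \<Rightarrow> ('p, 'n, 'z) cat_scheme
    \<Rightarrow> ('o, 'm, 'p, 'n) transf \<Rightarrow> ('o, 'm, 'p, 'n) transf \<Rightarrow> ('o, 'm, 'p, 'n) transf"
  where "vcomp_transf C D v u =
    \<lparr>Src = Src u, Tgt = Tgt v, Cmp = (\<lambda>X\<in>Obj C. Cmp v X \<cdot>\<^bsub>D\<^esub> Cmp u X)\<rparr>"

definition hcomp_transf ::
  "('o, 'm, 'x) unital_cat_scheme \<Rightarrow> ('q, 'k, 'z) unital_cat_scheme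
    \<Rightarrow> ('p, 'n, 'q, 'k) transf \<Rightarrow> ('o, 'm, 'p, 'n) transf \<Rightarrow> ('o, 'm, 'q, 'k) transf"
  where "hcomp_transf C E v u =
    \<lparr>Src = comp_mon_functor C E (Src v) (Src u),
     Tgt = comp_mon_functor C E (Tgt v) (Tgt u),
     Cmp = (\<lambda>X\<in>Obj C. Cmp v (obj_map (Tgt u) X) \<cdot>\<^bsub>E\<^esub> arr_map (Src v) (Cmp u X))\<rparr>"

text \<open>
  The 2-category with 0-cells the unital categories in \<open>S\<close>, 1-cells \<open>C \<rightarrow> D\<close> the functors
  satisfying \<open>P C D\<close>, and 2-cells the monoidal natural transformations.
\<close>

definition mon_hom_cat ::
  "(('o, 'm, 'z) unital_cat_scheme \<Rightarrow> ('o, 'm, 'z) unital_cat_scheme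
      \<Rightarrow> ('o, 'm, 'o, 'm) mon_functor \<Rightarrow> bool)
    \<Rightarrow> ('o, 'm, 'z) unital_cat_scheme \<Rightarrow> ('o, 'm, 'z) unital_cat_scheme
    \<Rightarrow> (('o, 'm, 'o, 'm) mon_functor, ('o, 'm, 'o, 'm) transf) cat"
  where "mon_hom_cat P C D =
    \<lparr>Obj = {F. P C D F},
     Arr = {u. P C D (Src u) \<and> P C D (Tgt u) \<and>
       monoidal_transf C D (Src u) (Tgt u) (Cmp u) \<and> Cmp u \<in> extensional (Obj C)},
     Dom = Src,
     Cod = Tgt,
     Ide = id_transf C D,
     Comp = vcomp_transf C D\<rparr>"

definition mon_two_cat ::
  "('o, 'm, 'z) unital_cat_scheme set
    \<Rightarrow> (('o, 'm, 'z) unital_cat_scheme \<Rightarrow> ('o, 'm, 'z) unital_cat_scheme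
      \<Rightarrow> ('o, 'm, 'o, 'm) mon_functor \<Rightarrow> bool)
    \<Rightarrow> (('o, 'm, 'z) unital_cat_scheme, ('o, 'm, 'o, 'm) mon_functor,
        ('o, 'm, 'o, 'm) transf) two_cat"
  where "mon_two_cat S P =
    \<lparr>Cell0 = S,
     HomCat = mon_hom_cat P,
     Id1 = id_mon_functor,
     HComp = (\<lambda>C D E.
       \<lparr>obj_map = (\<lambda>(G, F). comp_mon_functor C E G F),
        arr_map = (\<lambda>(v, u). hcomp_transf C E v u)\<rparr>)\<rparr>"

definition lr_two_cat ::
  "(('o, 'm) lr_cat, ('o, 'm, 'o, 'm) mon_functor, ('o, 'm, 'o, 'm) transf) two_cat"
  where "lr_two_cat = mon_two_cat {C. lr_monoidal C} lr_strong_monoidal"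

definition saavedra_two_cat ::
  "(('o, 'm) saavedra_cat, ('o, 'm, 'o, 'm) mon_functor, ('o, 'm, 'o, 'm) transf) two_cat"
  where "saavedra_two_cat = mon_two_cat {C. saavedra_monoidal C} saavedra_strong_monoidal"

end

theory Submission
  imports Defs
begin

text \<open>
  An LR unit \<open>(I, \<lambda>, \<rho>)\<close> gives the Saavedra unit \<open>(I, \<lambda>\<^sub>I)\<close>: tensoring with \<open>I\<close> is isomorphic to the
  identity functor, hence fully faithful.  Conversely, full faithfulness turns a Saavedra unit
  \<open>(I, \<alpha>)\<close> into an LR unit through the equations \<open>I \<lambda>\<^sub>X = \<alpha> X\<close> and \<open>\<rho>\<^sub>X I = X \<alpha>\<close>.  These two
  assignments are mutually inverse.  The two kinds of strong monoidal functors carry the same data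
  \<open>(F, \<phi>\<^sub>2, \<phi>\<^sub>0)\<close>, and since \<open>\<lambda>\<close> and \<open>\<rho>\<close> are determined by \<open>\<alpha>\<close>, the two unit compatibilities are
  equivalent.  So the hom-categories of the two 2-categories coincide, and the isomorphism is the
  identity on 1-cells and 2-cells.
\<close>

section \<open>Calculus of arrows in categories and semi-monoidal categories\<close>

text \<open>The middle axiom at X = I, combined with \<lambda>_I = \<rho>_I, reads I \<lambda>_X =
  \<lambda>_I X. So the left constraint of an LR unit solves the equation that determines the
  constraint built from \<lambda>_I, and cancellability leaves only one solution. In the other
  direction, naturality of the constructed \<lambda> at its own component \<lambda>_I forces
  \<lambda>_I = \<alpha>.

  For a functor, the Saavedra condition yields the LR conditions by comparing two arrows after
  composition with the invertible arrow built from \<phi>_2 and \<phi>_0; the way back is naturality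
  of the target's \<lambda> at \<phi>_0.

  The obstacle is strictness: the isomorphism asks for HOL equality of 0-, 1- and 2-cells, while the
  two kinds of categories live in different record types. Hence the 2-category laws are proved for
  an arbitrary class of functors with invertible \<phi>_0, and facts are carried between record
  types along equality of truncated records. Closure under composition is computed on the Saavedra
  side, where there is a single equation between two arrows, and then transferred to the LR
  side.\<close>

context category
begin

lemma homI: "f \<in> Arr C \<Longrightarrow> Dom C f = X \<Longrightarrow> Cod C f = Y \<Longrightarrow> f \<in> hom C X Y"
  by (auto simp: hom_def)

declare Dom_closed [simp] Cod_closed [simp]

lemma Ide_simps [simp]:
  assumes "X \<in> Obj C"
  shows "Ide C X \<in> Arr C" "Dom C (Ide C X) = X" "Cod C (Ide C X) = X"
  using Ide_hom [OF assms] by (auto simp: hom_def)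

lemma Comp_simps [simp]:
  assumes "f \<in> Arr C" "g \<in> Arr C" "Cod C f = Dom C g"
  shows "g \<cdot> f \<in> Arr C" "Dom C (g \<cdot> f) = Dom C f" "Cod C (g \<cdot> f) = Cod C g"
  using Comp_hom [of f "Dom C f" "Cod C f" g "Cod C g"] assms by (auto simp: hom_def)

lemma Comp_Ide_simps [simp]:
  "f \<in> Arr C \<Longrightarrow> Cod C f = X \<Longrightarrow> Ide C X \<cdot> f = f"
  "f \<in> Arr C \<Longrightarrow> Dom C f = X \<Longrightarrow> f \<cdot> Ide C X = f"
  by (auto intro: Comp_Ide_left Comp_Ide_right homI)

lemma Comp_assoc_arr [simp]:
  "\<lbrakk>f \<in> Arr C; g \<in> Arr C; h \<in> Arr C; Cod C f = Dom C g; Cod C g = Dom C h\<rbrakk>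
    \<Longrightarrow> (h \<cdot> g) \<cdot> f = h \<cdot> (g \<cdot> f)"
  by (rule Comp_assoc) (auto intro: homI)

text \<open>Lets the simplifier apply an equation \<open>h \<cdot> g = k\<close> inside right-nested composites.\<close>

lemma Comp_reassoc:
  assumes "h \<cdot> g = k" "f \<in> Arr C" "g \<in> Arr C" "h \<in> Arr C" "Cod C f = Dom C g" "Cod C g = Dom C h"
  shows "h \<cdot> (g \<cdot> f) = k \<cdot> f"
  using Comp_assoc_arr [of f g h] assms by simp

lemma iso_arrD:
  assumes "iso_arr C X Y f"
  shows "f \<in> Arr C" "Dom C f = X" "Cod C f = Y"
  using assms by (auto simp: iso_arr_def hom_def)

lemma iso_arrI:
  assumes "f \<in> Arr C" "Dom C f = X" "Cod C f = Y" "g \<in> Arr C" "Dom C g = Y" "Cod C g = X"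
    "g \<cdot> f = Ide C X" "f \<cdot> g = Ide C Y"
  shows "iso_arr C X Y f"
  using assms by (auto simp: iso_arr_def hom_def)

lemma iso_arrE:
  assumes "iso_arr C X Y f"
  obtains g where "g \<in> Arr C" "Dom C g = Y" "Cod C g = X" "g \<cdot> f = Ide C X" "f \<cdot> g = Ide C Y"
  using assms by (auto simp: iso_arr_def hom_def)

lemma iso_arr_Ide: "X \<in> Obj C \<Longrightarrow> iso_arr C X X (Ide C X)"
  by (rule iso_arrI [where g = "Ide C X"]) auto

lemma iso_arr_Comp:
  assumes f: "iso_arr C X Y f" and g: "iso_arr C Y Z g"
  shows "iso_arr C X Z (g \<cdot> f)"
proof -
  note [simp] = iso_arrD [OF f] iso_arrD [OF g]
  obtain f' where [simp]: "f' \<in> Arr C" "Dom C f' = Y" "Cod C f' = X"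
    and f': "f' \<cdot> f = Ide C X" "f \<cdot> f' = Ide C Y" using f by (rule iso_arrE)
  obtain g' where [simp]: "g' \<in> Arr C" "Dom C g' = Z" "Cod C g' = Y"
    and g': "g' \<cdot> g = Ide C Y" "g \<cdot> g' = Ide C Z" using g by (rule iso_arrE)
  show ?thesis
  proof (rule iso_arrI [where g = "f' \<cdot> g'"])
    show "(f' \<cdot> g') \<cdot> (g \<cdot> f) = Ide C X"
      using Comp_reassoc [OF g'(1)] f' by simp
    show "(g \<cdot> f) \<cdot> (f' \<cdot> g') = Ide C Z"
      using Comp_reassoc [OF f'(2)] g' by simp
  qed auto
qed

lemma iso_arr_cancel_left:
  assumes h: "iso_arr C X Y h" and f: "f \<in> Arr C" "Cod C f = X" and g: "g \<in> Arr C" "Cod C g = X"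
    and eq: "h \<cdot> f = h \<cdot> g"
  shows "f = g"
proof -
  note [simp] = iso_arrD [OF h] f g
  obtain k where k: "k \<in> Arr C" "Dom C k = Y" "k \<cdot> h = Ide C X" using h by (rule iso_arrE)
  have "k \<cdot> (h \<cdot> f) = k \<cdot> (h \<cdot> g)" by (simp add: eq)
  then show ?thesis using Comp_reassoc [OF k(3)] k by simp
qed

lemma iso_arr_cancel_right:
  assumes h: "iso_arr C X Y h" and f: "f \<in> Arr C" "Dom C f = Y" and g: "g \<in> Arr C" "Dom C g = Y"
    and eq: "f \<cdot> h = g \<cdot> h"
  shows "f = g"
proof -
  note [simp] = iso_arrD [OF h] f g
  obtain k where k: "k \<in> Arr C" "Cod C k = X" "Dom C k = Y" "h \<cdot> k = Ide C Y"
    using h by (rule iso_arrE)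
  have "(f \<cdot> h) \<cdot> k = (g \<cdot> h) \<cdot> k" by (simp add: eq)
  then show ?thesis using k by simp
qed

end

lemma prod_cat_simps [simp]:
  "Obj (prod_cat C D) = Obj C \<times> Obj D"
  "Arr (prod_cat C D) = Arr C \<times> Arr D"
  "Dom (prod_cat C D) (f, g) = (Dom C f, Dom D g)"
  "Cod (prod_cat C D) (f, g) = (Cod C f, Cod D g)"
  "Ide (prod_cat C D) (X, Y) = (Ide C X, Ide D Y)"
  "(f', g') \<cdot>\<^bsub>prod_cat C D\<^esub> (f, g) = (f' \<cdot>\<^bsub>C\<^esub> f, g' \<cdot>\<^bsub>D\<^esub> g)"
  by (auto simp: prod_cat_def)

lemma category_prod_cat:
  assumes "category C" "category D"
  shows "category (prod_cat C D)"
proof -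
  interpret C: category C by fact
  interpret D: category D by fact
  show ?thesis
    by unfold_locales (auto simp: hom_def)
qed

context cat_functor
begin

declare obj_map_closed [simp] arr_map_Ide [simp]

lemma arr_map_simps [simp]:
  assumes "f \<in> Arr C"
  shows "arr_map F f \<in> Arr D" "Dom D (arr_map F f) = obj_map F (Dom C f)"
    "Cod D (arr_map F f) = obj_map F (Cod C f)"
  using arr_map_hom [of f "Dom C f" "Cod C f"] assms by (auto simp: hom_def)

lemma arr_map_Comp_arr [simp]:
  "\<lbrakk>f \<in> Arr C; g \<in> Arr C; Cod C f = Dom C g\<rbrakk>
    \<Longrightarrow> arr_map F (g \<cdot>\<^bsub>C\<^esub> f) = arr_map F g \<cdot>\<^bsub>D\<^esub> arr_map F f"
  by (rule arr_map_Comp) (auto intro: C.homI)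

lemma arr_map_iso:
  assumes "iso_arr C X Y f"
  shows "iso_arr D (obj_map F X) (obj_map F Y) (arr_map F f)"
proof -
  note [simp] = C.iso_arrD [OF assms]
  obtain g where [simp]: "g \<in> Arr C" "Dom C g = Y" "Cod C g = X"
    and g: "g \<cdot>\<^bsub>C\<^esub> f = Ide C X" "f \<cdot>\<^bsub>C\<^esub> g = Ide C Y" using assms by (rule C.iso_arrE)
  have "X \<in> Obj C" "Y \<in> Obj C"
    using C.Dom_closed [of f] C.Cod_closed [of f] by simp_all
  then show ?thesis
    by (intro D.iso_arrI [where g = "arr_map F g"])
      (simp_all flip: arr_map_Comp_arr add: g)
qed

end

lemma cat_functorI:
  assumes "category C" "category D"
    and "\<And>X. X \<in> Obj C \<Longrightarrow> obj_map F X \<in> Obj D"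
    and "\<And>f. f \<in> Arr C \<Longrightarrow> arr_map F f \<in> Arr D"
    and "\<And>f. f \<in> Arr C \<Longrightarrow> Dom D (arr_map F f) = obj_map F (Dom C f)"
    and "\<And>f. f \<in> Arr C \<Longrightarrow> Cod D (arr_map F f) = obj_map F (Cod C f)"
    and "\<And>X. X \<in> Obj C \<Longrightarrow> arr_map F (Ide C X) = Ide D (obj_map F X)"
    and "\<And>f g. \<lbrakk>f \<in> Arr C; g \<in> Arr C; Cod C f = Dom C g\<rbrakk>
      \<Longrightarrow> arr_map F (g \<cdot>\<^bsub>C\<^esub> f) = arr_map F g \<cdot>\<^bsub>D\<^esub> arr_map F f"
  shows "cat_functor C D F"
  using assms unfolding cat_functor_def cat_functor_axioms_def hom_def by auto

lemma comp_functor_simps [simp]: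
  "X \<in> Obj C \<Longrightarrow> obj_map (comp_functor C G F) X = obj_map G (obj_map F X)"
  "f \<in> Arr C \<Longrightarrow> arr_map (comp_functor C G F) f = arr_map G (arr_map F f)"
  by (simp_all add: comp_functor_def)

lemma prod_functor_simps [simp]:
  "obj_map (prod_functor F G) (X, Y) = (obj_map F X, obj_map G Y)"
  "arr_map (prod_functor F G) (f, g) = (arr_map F f, arr_map G g)"
  by (simp_all add: prod_functor_def)

lemma cat_functor_comp:
  assumes "cat_functor C D F" "cat_functor D E G"
  shows "cat_functor C E (comp_functor C G F)"
proof -
  interpret F: cat_functor C D F by fact
  interpret G: cat_functor D E G by fact
  show ?thesis by (rule cat_functorI) (unfold_locales, auto)
qed

lemma cat_functor_prod:
  assumes "cat_functor C D F" "cat_functor C' D' F'"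
  shows "cat_functor (prod_cat C C') (prod_cat D D') (prod_functor F F')"
proof -
  interpret F: cat_functor C D F by fact
  interpret F': cat_functor C' D' F' by fact
  show ?thesis
    by (rule cat_functorI) (auto intro: category_prod_cat F.C.category_axioms F.D.category_axioms
      F'.C.category_axioms F'.D.category_axioms)
qed

lemma cat_functor_id: "category C \<Longrightarrow> cat_functor C C (id_functor C)"
  by (rule cat_functorI) (auto simp: id_functor_def category.Dom_closed category.Cod_closed
    category.Ide_simps category.Comp_simps)

lemma (in nat_transf) component_simps [simp]:
  assumes "X \<in> Obj C"
  shows "u X \<in> Arr D" "Dom D (u X) = obj_map F X" "Cod D (u X) = obj_map G X"
  using component_hom [OF assms] by (auto simp: hom_def)

lemma (in nat_transf) naturality_arr:
  "f \<in> Arr C \<Longrightarrow> u (Cod C f) \<cdot>\<^bsub>D\<^esub> arr_map F f = arr_map G f \<cdot>\<^bsub>D\<^esub> u (Dom C f)"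
  by (rule naturality) (auto intro: F.C.homI)

lemma nat_transfI:
  assumes "cat_functor C D F" "cat_functor C D G"
    and "\<And>X. X \<in> Obj C \<Longrightarrow> u X \<in> Arr D"
    and "\<And>X. X \<in> Obj C \<Longrightarrow> Dom D (u X) = obj_map F X"
    and "\<And>X. X \<in> Obj C \<Longrightarrow> Cod D (u X) = obj_map G X"
    and "\<And>f. f \<in> Arr C \<Longrightarrow> u (Cod C f) \<cdot>\<^bsub>D\<^esub> arr_map F f = arr_map G f \<cdot>\<^bsub>D\<^esub> u (Dom C f)"
  shows "nat_transf C D F G u"
  using assms unfolding nat_transf_def nat_transf_axioms_def hom_def by auto

lemma nat_isoI:
  assumes "cat_functor C D F" "cat_functor C D G"
    and "\<And>X. X \<in> Obj C \<Longrightarrow> iso_arr D (obj_map F X) (obj_map G X) (u X)"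
    and "\<And>f. f \<in> Arr C \<Longrightarrow> u (Cod C f) \<cdot>\<^bsub>D\<^esub> arr_map F f = arr_map G f \<cdot>\<^bsub>D\<^esub> u (Dom C f)"
  shows "nat_iso C D F G u"
proof -
  have "category D" using assms(1) by (simp add: cat_functor_def)
  then have "nat_transf C D F G u"
    using assms by (intro nat_transfI) (auto dest: category.iso_arrD)
  then show ?thesis using assms(3) by (simp add: nat_iso_def nat_iso_axioms_def)
qed

context semimonoidal
begin

lemma tens_obj_closed [simp]: "X \<in> Obj C \<Longrightarrow> Y \<in> Obj C \<Longrightarrow> X \<odot> Y \<in> Obj C"
  using cat_functor.obj_map_closed [OF Tens_functor, of "(X, Y)"] by simp

lemma tens_arr_simps [simp]:
  assumes "f \<in> Arr C" "g \<in> Arr C"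
  shows "f \<otimes> g \<in> Arr C" "Dom C (f \<otimes> g) = Dom C f \<odot> Dom C g"
    "Cod C (f \<otimes> g) = Cod C f \<odot> Cod C g"
  using cat_functor.arr_map_simps [OF Tens_functor, of "(f, g)"] assms by simp_all

lemma tens_Ide [simp]: "X \<in> Obj C \<Longrightarrow> Y \<in> Obj C \<Longrightarrow> Ide C X \<otimes> Ide C Y = Ide C (X \<odot> Y)"
  using cat_functor.arr_map_Ide [OF Tens_functor, of "(X, Y)"] by simp

lemma interchange [simp]:
  "\<lbrakk>f \<in> Arr C; g \<in> Arr C; f' \<in> Arr C; g' \<in> Arr C; Cod C f = Dom C f'; Cod C g = Dom C g'\<rbrakk>
    \<Longrightarrow> (f' \<otimes> g') \<cdot> (f \<otimes> g) = (f' \<cdot> f) \<otimes> (g' \<cdot> g)"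
  using cat_functor.arr_map_Comp_arr [OF Tens_functor, of "(f, g)" "(f', g')"] by simp

declare tens_obj_assoc [simp] tens_arr_assoc [simp]

text \<open>Right association is the normal form of the simplifier and keeps the two identities
  apart, out of reach of \<open>tens_Ide\<close>. This rule fuses them, and its reverse splits them
  again.\<close>

lemma tens_Ide_Ide: "\<lbrakk>f \<in> Arr C; X \<in> Obj C; Y \<in> Obj C\<rbrakk>
    \<Longrightarrow> Ide C X \<otimes> (Ide C Y \<otimes> f) = Ide C (X \<odot> Y) \<otimes> f"
  by (simp flip: tens_arr_assoc tens_Ide)

text \<open>A pair of isomorphisms is an isomorphism of the product category, and the tensor is a
  functor on that category.\<close>

lemma tens_iso:
  assumes f: "iso_arr C X Y f" and g: "iso_arr C X' Y' g"
  shows "iso_arr C (X \<odot> X') (Y \<odot> Y') (f \<otimes> g)"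
proof -
  have "iso_arr (prod_cat C C) (X, X') (Y, Y') (f, g)"
    using f g by (force simp: iso_arr_def hom_def)
  from cat_functor.arr_map_iso [OF Tens_functor this] show ?thesis .
qed

lemma cat_functor_tens_left: "I \<in> Obj C \<Longrightarrow> cat_functor C C (tens_left C I)"
  by (rule cat_functorI) (unfold_locales, auto simp: tens_left_def)

lemma cat_functor_tens_right: "I \<in> Obj C \<Longrightarrow> cat_functor C C (tens_right C I)"
  by (rule cat_functorI) (unfold_locales, auto simp: tens_right_def)

end

section \<open>LR units and Saavedra units\<close>

lemma id_functor_simps [simp]:
  "X \<in> Obj C \<Longrightarrow> obj_map (id_functor C) X = X"
  "f \<in> Arr C \<Longrightarrow> arr_map (id_functor C) f = f"
  by (simp_all add: id_functor_def)

lemma tens_left_simps [simp]: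
  "obj_map (tens_left C I) X = I \<odot>\<^bsub>C\<^esub> X" "arr_map (tens_left C I) f = Ide C I \<otimes>\<^bsub>C\<^esub> f"
  by (simp_all add: tens_left_def)

lemma tens_right_simps [simp]:
  "obj_map (tens_right C I) X = X \<odot>\<^bsub>C\<^esub> I" "arr_map (tens_right C I) f = f \<otimes>\<^bsub>C\<^esub> Ide C I"
  by (simp_all add: tens_right_def)

lemma fully_faithful_inj:
  assumes "fully_faithful C D F" "f \<in> Arr C" "g \<in> Arr C" "Dom C f = Dom C g" "Cod C f = Cod C g"
    "arr_map F f = arr_map F g"
  shows "f = g"
proof -
  interpret cat_functor C D F using assms by (simp add: fully_faithful_def)
  have "inj_on (arr_map F) (hom C (Dom C f) (Cod C f))"
    using assms by (simp add: fully_faithful_def bij_betw_def)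
  then show ?thesis using assms by (auto simp: inj_on_def hom_def)
qed

lemma fully_faithful_surj:
  assumes "fully_faithful C D F" "X \<in> Obj C" "Y \<in> Obj C" "g \<in> Arr D"
    "Dom D g = obj_map F X" "Cod D g = obj_map F Y"
  obtains f where "f \<in> Arr C" "Dom C f = X" "Cod C f = Y" "arr_map F f = g"
proof -
  have "g \<in> arr_map F ` hom C X Y"
    using assms by (simp add: fully_faithful_def bij_betw_def hom_def)
  then show ?thesis using that by (auto simp: hom_def)
qed

text \<open>Fullness lifts the inverse of the image to an arrow \<open>g\<close>; faithfulness lifts
  the two inverse laws.\<close>

lemma fully_faithful_reflects_iso:
  assumes ff: "fully_faithful C D F" and f: "f \<in> Arr C" "Dom C f = X" "Cod C f = Y"
    and iso: "iso_arr D (obj_map F X) (obj_map F Y) (arr_map F f)"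
  shows "iso_arr C X Y f"
proof -
  interpret cat_functor C D F using ff by (simp add: fully_faithful_def)
  have XY [simp]: "X \<in> Obj C" "Y \<in> Obj C"
    using f C.Dom_closed [of f] C.Cod_closed [of f] by simp_all
  obtain h where h: "h \<in> Arr D" "Dom D h = obj_map F Y" "Cod D h = obj_map F X"
    "h \<cdot>\<^bsub>D\<^esub> arr_map F f = Ide D (obj_map F X)" "arr_map F f \<cdot>\<^bsub>D\<^esub> h = Ide D (obj_map F Y)"
    using iso by (rule D.iso_arrE)
  obtain g where g: "g \<in> Arr C" "Dom C g = Y" "Cod C g = X" "arr_map F g = h"
    using fully_faithful_surj [OF ff XY(2) XY(1) h(1-3)] .
  show ?thesis
    by (rule C.iso_arrI [where g = g]; (rule fully_faithful_inj [OF ff])?)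
      (use f g h in simp_all)
qed

text \<open>Naturality says that \<open>F\<close> acts on arrows by conjugation with the invertible
  components of \<open>u\<close>, and conjugation is a bijection on hom-sets.\<close>

lemma fully_faithful_nat_iso_id:
  assumes "nat_iso C C F (id_functor C) u"
  shows "fully_faithful C C F"
proof -
  interpret nat_iso C C F "id_functor C" u by fact
  have iso: "iso_arr C (obj_map F X) X (u X)" if "X \<in> Obj C" for X
    using component_iso [OF that] that by simp
  have nat: "u (Cod C f) \<cdot>\<^bsub>C\<^esub> arr_map F f = f \<cdot>\<^bsub>C\<^esub> u (Dom C f)" if "f \<in> Arr C" for f
    using naturality_arr [OF that] that by simp
  have "bij_betw (arr_map F) (hom C X Y) (hom C (obj_map F X) (obj_map F Y))"
    if XY [simp]: "X \<in> Obj C" "Y \<in> Obj C" for X Y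
    unfolding bij_betw_def
  proof (intro conjI equalityI subsetI inj_onI)
    fix f g assume f: "f \<in> hom C X Y" and g: "g \<in> hom C X Y" and eq: "arr_map F f = arr_map F g"
    have "f \<cdot>\<^bsub>C\<^esub> u X = g \<cdot>\<^bsub>C\<^esub> u X"
      using nat [of f] nat [of g] f g eq by (simp add: hom_def)
    then show "f = g"
      by (rule F.C.iso_arr_cancel_right [OF iso [OF XY(1)], rotated 4])
        (use f g in \<open>simp_all add: hom_def\<close>)
  next
    fix g assume "g \<in> hom C (obj_map F X) (obj_map F Y)"
    then have g: "g \<in> Arr C" "Dom C g = obj_map F X" "Cod C g = obj_map F Y"
      by (auto simp: hom_def)
    obtain k where k: "k \<in> Arr C" "Dom C k = X" "Cod C k = obj_map F X"
      "k \<cdot>\<^bsub>C\<^esub> u X = Ide C (obj_map F X)" "u X \<cdot>\<^bsub>C\<^esub> k = Ide C X"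
      using iso [OF XY(1)] by (rule F.C.iso_arrE)
    \<comment> \<open>The preimage of \<open>g\<close> is found by solving the naturality square for
      the arrow of \<open>C\<close>; \<open>k\<close> is the inverse of \<open>u X\<close>.\<close>
    let ?f = "u Y \<cdot>\<^bsub>C\<^esub> (g \<cdot>\<^bsub>C\<^esub> k)"
    have f: "?f \<in> Arr C" "Dom C ?f = X" "Cod C ?f = Y"
      using g k by simp_all
    have "u Y \<cdot>\<^bsub>C\<^esub> arr_map F ?f = u Y \<cdot>\<^bsub>C\<^esub> g"
      using nat [OF f(1)] f g k by simp
    then have "arr_map F ?f = g"
      by (rule F.C.iso_arr_cancel_left [OF iso [OF XY(2)], rotated 4])
        (use f g in simp_all)
    then show "g \<in> arr_map F ` hom C X Y"
      using f by (force simp: hom_def)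
  qed (auto intro: F.arr_map_hom)
  then show ?thesis
    by (simp add: fully_faithful_def F.cat_functor_axioms)
qed

section \<open>From LR units to Saavedra units\<close>

context lr_unit
begin

lemma l_iso: "X \<in> Obj C \<Longrightarrow> iso_arr C (I \<odot> X) X (l X)"
  using nat_iso.component_iso [OF l_nat_iso, of X] by simp

lemma r_iso: "X \<in> Obj C \<Longrightarrow> iso_arr C (X \<odot> I) X (r X)"
  using nat_iso.component_iso [OF r_nat_iso, of X] by simp

lemma saavedra_unit_of_lr: "saavedra_unit C I (l I)"
proof
  show "cancellable C I"
    using fully_faithful_nat_iso_id [OF l_nat_iso] fully_faithful_nat_iso_id [OF r_nat_iso] lr_unit_obj
    by (simp add: cancellable_def)
  show "iso_arr C (I \<odot> I) I (l I)"
    by (rule l_iso) (rule lr_unit_obj)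
qed

end

section \<open>From Saavedra units to LR units\<close>

text \<open>For a Saavedra unit the description is met by exactly one arrow: fullness of tensoring
  with \<open>I\<close> gives existence, faithfulness gives uniqueness. The restriction to objects
  makes the family extensional, as \<open>lr_monoidal\<close> demands of \<open>Lam\<close>.\<close>

definition left_constraint :: "('o, 'm, 'z) semimon_cat_scheme \<Rightarrow> 'o \<Rightarrow> 'm \<Rightarrow> 'o \<Rightarrow> 'm"
  where "left_constraint C I a = (\<lambda>X\<in>Obj C. THE f.
    f \<in> hom C (I \<odot>\<^bsub>C\<^esub> X) X \<and> Ide C I \<otimes>\<^bsub>C\<^esub> f = a \<otimes>\<^bsub>C\<^esub> Ide C X)"

definition right_constraint :: "('o, 'm, 'z) semimon_cat_scheme \<Rightarrow> 'o \<Rightarrow> 'm \<Rightarrow> 'o \<Rightarrow> 'm"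
  where "right_constraint C I a = (\<lambda>X\<in>Obj C. THE f.
    f \<in> hom C (X \<odot>\<^bsub>C\<^esub> I) X \<and> f \<otimes>\<^bsub>C\<^esub> Ide C I = Ide C X \<otimes>\<^bsub>C\<^esub> a)"

context saavedra_unit
begin

lemma unit_obj [simp]: "I \<in> Obj C"
  using unit_cancellable by (simp add: cancellable_def)

lemmas a_simps [simp] = iso_arrD [OF a_iso]

lemma cancel_left:
  "\<lbrakk>Ide C I \<otimes> f = Ide C I \<otimes> g; f \<in> Arr C; g \<in> Arr C; Dom C f = Dom C g; Cod C f = Cod C g\<rbrakk>
    \<Longrightarrow> f = g"
  using fully_faithful_inj [of C C "tens_left C I" f g] unit_cancellable by (simp add: cancellable_def)

lemma cancel_right:
  "\<lbrakk>f \<otimes> Ide C I = g \<otimes> Ide C I; f \<in> Arr C; g \<in> Arr C; Dom C f = Dom C g; Cod C f = Cod C g\<rbrakk>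
    \<Longrightarrow> f = g"
  using fully_faithful_inj [of C C "tens_right C I" f g] unit_cancellable by (simp add: cancellable_def)

abbreviation "l \<equiv> left_constraint C I a"
abbreviation "r \<equiv> right_constraint C I a"

text \<open>The working principle for all later identities: an arrow is recognised as a left
  constraint by its type and one equation after tensoring with \<open>I\<close>, because
  \<open>I\<close> can be cancelled.\<close>

lemma left_constraint_eqI:
  assumes "f \<in> Arr C" "Dom C f = I \<odot> X" "Cod C f = X" "Ide C I \<otimes> f = a \<otimes> Ide C X"
  shows "l X = f"
proof -
  have "X \<in> Obj C" using assms Cod_closed [of f] by simp
  moreover have "(THE f. f \<in> hom C (I \<odot> X) X \<and> Ide C I \<otimes> f = a \<otimes> Ide C X) = f"
    by (rule the_equality) (use assms in \<open>auto simp: hom_def intro: cancel_left\<close>)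
  ultimately show ?thesis by (simp add: left_constraint_def)
qed

lemma right_constraint_eqI:
  assumes "f \<in> Arr C" "Dom C f = X \<odot> I" "Cod C f = X" "f \<otimes> Ide C I = Ide C X \<otimes> a"
  shows "r X = f"
proof -
  have "X \<in> Obj C" using assms Cod_closed [of f] by simp
  moreover have "(THE f. f \<in> hom C (X \<odot> I) X \<and> f \<otimes> Ide C I = Ide C X \<otimes> a) = f"
    by (rule the_equality) (use assms in \<open>auto simp: hom_def intro: cancel_right\<close>)
  ultimately show ?thesis by (simp add: right_constraint_def)
qed

text \<open>Fullness of \<open>tens_left\<close> supplies a preimage of
  \<open>a \<otimes> Ide C X\<close>, and \<open>left_constraint_eqI\<close> identifies it with
  \<open>l X\<close>.\<close>

lemma
  assumes [simp]: "X \<in> Obj C"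
  shows left_constraint_simps [simp]:
      "l X \<in> Arr C" "Dom C (l X) = I \<odot> X" "Cod C (l X) = X"
    and left_constraint_tens: "Ide C I \<otimes> l X = a \<otimes> Ide C X"
proof -
  have "fully_faithful C C (tens_left C I)"
    using unit_cancellable by (simp add: cancellable_def)
  then obtain f where f: "f \<in> Arr C" "Dom C f = I \<odot> X" "Cod C f = X" "Ide C I \<otimes> f = a \<otimes> Ide C X"
    by (rule fully_faithful_surj [of C C "tens_left C I" "I \<odot> X" X "a \<otimes> Ide C X"]) simp_all
  with left_constraint_eqI [OF f]
  show "l X \<in> Arr C" "Dom C (l X) = I \<odot> X" "Cod C (l X) = X" "Ide C I \<otimes> l X = a \<otimes> Ide C X"
    by simp_all
qed

lemma
  assumes [simp]: "X \<in> Obj C"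
  shows right_constraint_simps [simp]:
      "r X \<in> Arr C" "Dom C (r X) = X \<odot> I" "Cod C (r X) = X"
    and right_constraint_tens: "r X \<otimes> Ide C I = Ide C X \<otimes> a"
proof -
  have "fully_faithful C C (tens_right C I)"
    using unit_cancellable by (simp add: cancellable_def)
  then obtain f where f: "f \<in> Arr C" "Dom C f = X \<odot> I" "Cod C f = X" "f \<otimes> Ide C I = Ide C X \<otimes> a"
    by (rule fully_faithful_surj [of C C "tens_right C I" "X \<odot> I" X "Ide C X \<otimes> a"]) simp_all
  with right_constraint_eqI [OF f]
  show "r X \<in> Arr C" "Dom C (r X) = X \<odot> I" "Cod C (r X) = X" "r X \<otimes> Ide C I = Ide C X \<otimes> a"
    by simp_all
qed

text \<open>Tensoring \<open>l X\<close> with \<open>I\<close> produces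
  \<open>a \<otimes> Ide C X\<close>, which is invertible, and fully faithful functors reflect
  isomorphisms.\<close>

lemma left_constraint_iso:
  assumes [simp]: "X \<in> Obj C"
  shows "iso_arr C (I \<odot> X) X (l X)"
proof (rule fully_faithful_reflects_iso)
  show "fully_faithful C C (tens_left C I)"
    using unit_cancellable by (simp add: cancellable_def)
  show "iso_arr C (obj_map (tens_left C I) (I \<odot> X)) (obj_map (tens_left C I) X)
      (arr_map (tens_left C I) (l X))"
    using tens_iso [OF a_iso iso_arr_Ide [OF assms]] by (simp add: left_constraint_tens)
qed simp_all

lemma right_constraint_iso:
  assumes [simp]: "X \<in> Obj C"
  shows "iso_arr C (X \<odot> I) X (r X)"
proof (rule fully_faithful_reflects_iso)
  show "fully_faithful C C (tens_right C I)"
    using unit_cancellable by (simp add: cancellable_def)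
  show "iso_arr C (obj_map (tens_right C I) (X \<odot> I)) (obj_map (tens_right C I) X)
      (arr_map (tens_right C I) (r X))"
    using tens_iso [OF iso_arr_Ide [OF assms] a_iso] by (simp add: right_constraint_tens)
qed simp_all

text \<open>After tensoring with \<open>I\<close> on the left, the interchange law turns both sides
  into \<open>a \<otimes> f\<close>.\<close>

lemma left_constraint_natural:
  assumes [simp]: "f \<in> Arr C"
  shows "l (Cod C f) \<cdot> (Ide C I \<otimes> f) = f \<cdot> l (Dom C f)"
proof (rule cancel_left)
  have "Ide C I \<otimes> (l (Cod C f) \<cdot> (Ide C I \<otimes> f))
      = (Ide C I \<otimes> l (Cod C f)) \<cdot> (Ide C I \<otimes> (Ide C I \<otimes> f))"
    by simp
  also have "\<dots> = (Ide C I \<otimes> f) \<cdot> (Ide C I \<otimes> l (Dom C f))"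
    unfolding left_constraint_tens [OF Dom_closed [OF assms]]
      left_constraint_tens [OF Cod_closed [OF assms]]
    by (simp add: tens_Ide_Ide)
  also have "\<dots> = Ide C I \<otimes> (f \<cdot> l (Dom C f))" by simp
  finally show "Ide C I \<otimes> (l (Cod C f) \<cdot> (Ide C I \<otimes> f)) = Ide C I \<otimes> (f \<cdot> l (Dom C f))" .
qed simp_all

lemma right_constraint_natural:
  assumes [simp]: "f \<in> Arr C"
  shows "r (Cod C f) \<cdot> (f \<otimes> Ide C I) = f \<cdot> r (Dom C f)"
proof (rule cancel_right)
  have "(r (Cod C f) \<cdot> (f \<otimes> Ide C I)) \<otimes> Ide C I
      = (r (Cod C f) \<otimes> Ide C I) \<cdot> (f \<otimes> Ide C I \<otimes> Ide C I)"
    \<comment> \<open>Reassociating would pair \<open>r (Cod C f)\<close> with \<open>f\<close>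
      alone, and the interchange law would no longer fit the types.\<close>
    by (simp del: tens_arr_assoc)
  also have "\<dots> = (f \<otimes> Ide C I) \<cdot> (r (Dom C f) \<otimes> Ide C I)"
    unfolding right_constraint_tens [OF Dom_closed [OF assms]]
      right_constraint_tens [OF Cod_closed [OF assms]]
    by simp
  also have "\<dots> = (f \<cdot> r (Dom C f)) \<otimes> Ide C I" by simp
  finally show "(r (Cod C f) \<cdot> (f \<otimes> Ide C I)) \<otimes> Ide C I = (f \<cdot> r (Dom C f)) \<otimes> Ide C I" .
qed simp_all

text \<open>Tensoring on the right with \<open>Y\<close> preserves the equation that characterises
  \<open>l X\<close>, so uniqueness applies.\<close>

lemma left_constraint_tens_obj:
  assumes [simp]: "X \<in> Obj C" "Y \<in> Obj C"
  shows "l (X \<odot> Y) = l X \<otimes> Ide C Y"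
proof (rule left_constraint_eqI)
  have "Ide C I \<otimes> (l X \<otimes> Ide C Y) = (Ide C I \<otimes> l X) \<otimes> Ide C Y" by simp
  also have "\<dots> = a \<otimes> Ide C (X \<odot> Y)"
    unfolding left_constraint_tens [OF assms(1)] by simp
  finally show "Ide C I \<otimes> (l X \<otimes> Ide C Y) = a \<otimes> Ide C (X \<odot> Y)" .
qed simp_all

lemma right_constraint_tens_obj:
  assumes [simp]: "X \<in> Obj C" "Y \<in> Obj C"
  shows "r (X \<odot> Y) = Ide C X \<otimes> r Y"
proof (rule right_constraint_eqI)
  show "(Ide C X \<otimes> r Y) \<otimes> Ide C I = Ide C (X \<odot> Y) \<otimes> a"
    by (simp add: right_constraint_tens tens_Ide_Ide)
qed simp_all

text \<open>
  Expanding \<open>r\<^sub>X \<otimes> l\<^sub>Y\<close> in the two possible ways gives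
  \<open>(r\<^sub>X \<otimes> Y) (X \<otimes> I \<otimes> l\<^sub>Y) = (X \<otimes> l\<^sub>Y) (r\<^sub>X \<otimes> I \<otimes> Y)\<close>, and both right-hand factors
  are the isomorphism \<open>X \<otimes> a \<otimes> Y\<close>.
\<close>

lemma constraint_middle:
  assumes [simp]: "X \<in> Obj C" "Y \<in> Obj C"
  shows "Ide C X \<otimes> l Y = r X \<otimes> Ide C Y"
proof (rule iso_arr_cancel_right)
  show "iso_arr C (X \<odot> (I \<odot> I \<odot> Y)) (X \<odot> (I \<odot> Y)) (Ide C X \<otimes> (a \<otimes> Ide C Y))"
    by (intro tens_iso iso_arr_Ide a_iso) simp_all
  have "(Ide C X \<otimes> l Y) \<cdot> (Ide C X \<otimes> (a \<otimes> Ide C Y)) = (Ide C X \<otimes> l Y) \<cdot> (r X \<otimes> Ide C (I \<odot> Y))"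
    using arg_cong [OF right_constraint_tens [OF assms(1)], of "\<lambda>f. f \<otimes> Ide C Y"] by simp
  also have "\<dots> = (r X \<otimes> Ide C Y) \<cdot> (Ide C (X \<odot> I) \<otimes> l Y)" by simp
  also have "Ide C (X \<odot> I) \<otimes> l Y = Ide C X \<otimes> (a \<otimes> Ide C Y)"
    by (simp add: left_constraint_tens flip: tens_Ide_Ide)
  finally show "(Ide C X \<otimes> l Y) \<cdot> (Ide C X \<otimes> (a \<otimes> Ide C Y))
    = (r X \<otimes> Ide C Y) \<cdot> (Ide C X \<otimes> (a \<otimes> Ide C Y))" .
qed simp_all

text \<open>Naturality of \<open>l\<close> at \<open>l\<^sub>I\<close> gives \<open>I \<otimes> l\<^sub>I = l\<^sub>I\<^sub>I = l\<^sub>I \<otimes> I\<close>.\<close>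

lemma left_constraint_unit: "l I = a"
proof (rule cancel_right)
  have "l I \<cdot> (Ide C I \<otimes> l I) = l I \<cdot> l (I \<odot> I)"
    using left_constraint_natural [of "l I"] by simp
  then have "Ide C I \<otimes> l I = l (I \<odot> I)"
    by (rule iso_arr_cancel_left [OF left_constraint_iso, rotated 5]) simp_all
  \<comment> \<open>By construction the left side of the previous equation is also
    \<open>a \<otimes> Ide C I\<close>; cancelling \<open>I\<close> on the right then gives the
    claim.\<close>
  then show "l I \<otimes> Ide C I = a \<otimes> Ide C I"
    by (simp add: left_constraint_tens left_constraint_tens_obj)
qed simp_all

text \<open>The mirror argument: naturality at \<open>r I\<close> and cancellation of
  \<open>r I\<close> give r_I I = r_II = I r_I, while r_I I is I a by construction. Together with
  \<open>left_constraint_unit\<close> this yields the LR axiom \<lambda>_I = \<rho>_I.\<close>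

lemma right_constraint_unit: "r I = a"
proof (rule cancel_left)
  have "r I \<cdot> (r I \<otimes> Ide C I) = r I \<cdot> r (I \<odot> I)"
    using right_constraint_natural [of "r I"] by simp
  then have "r I \<otimes> Ide C I = r (I \<odot> I)"
    by (rule iso_arr_cancel_left [OF right_constraint_iso, rotated 5]) simp_all
  then show "Ide C I \<otimes> r I = Ide C I \<otimes> a"
    by (simp add: right_constraint_tens right_constraint_tens_obj)
qed simp_all

lemma lr_unit_of_saavedra: "lr_unit C I l r"
proof (intro lr_unit.intro lr_unit_axioms.intro semimonoidal_axioms)
  show "nat_iso C C (tens_left C I) (id_functor C) l"
    by (rule nat_isoI) (auto intro: cat_functor_tens_left cat_functor_id category_axioms
      left_constraint_iso simp: left_constraint_natural)
  show "nat_iso C C (tens_right C I) (id_functor C) r"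
    by (rule nat_isoI) (auto intro: cat_functor_tens_right cat_functor_id category_axioms
      right_constraint_iso simp: right_constraint_natural)
qed (simp_all add: left_constraint_unit right_constraint_unit left_constraint_tens_obj
    right_constraint_tens_obj constraint_middle)

end

section \<open>Recovering the constraints of an LR unit\<close>

context lr_unit
begin

text \<open>The axioms give I \<lambda>_X = \<rho>_I X = \<lambda>_I X, which is the characterising
  equation for the constraint built from \<lambda>_I.\<close>

lemma left_constraint_of_lr:
  assumes "X \<in> Obj C" shows "left_constraint C I (l I) X = l X"
proof -
  interpret saavedra_unit C I "l I" by (rule saavedra_unit_of_lr)
  show ?thesis
    by (rule left_constraint_eqI)
      (use assms iso_arrD [OF l_iso [OF assms]] in \<open>simp_all add: middle l_I_eq_r_I\<close>)
qed

text \<open>Here the characterising equation \<rho>_X I = X \<lambda>_I is the middle axiom itself,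
  taken at Y = I.\<close>

lemma right_constraint_of_lr:
  assumes "X \<in> Obj C" shows "right_constraint C I (l I) X = r X"
proof -
  interpret saavedra_unit C I "l I" by (rule saavedra_unit_of_lr)
  show ?thesis
    by (rule right_constraint_eqI)
      (use assms iso_arrD [OF r_iso [OF assms]] in \<open>simp_all flip: middle\<close>)
qed

end

section \<open>Strong monoidal functors and units\<close>

context strong_multiplicative
begin

lemma Phi2_iso:
  "X \<in> Obj C \<Longrightarrow> Y \<in> Obj C \<Longrightarrow>
    iso_arr D (obj_map F X \<odot>\<^bsub>D\<^esub> obj_map F Y) (obj_map F (X \<odot>\<^bsub>C\<^esub> Y)) (Phi2 F (X, Y))"
  using nat_iso.component_iso [OF Phi2_nat_iso, of "(X, Y)"] by simp

lemmas Phi2_simps [simp] = D.iso_arrD [OF Phi2_iso]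

lemma Phi2_natural:
  "f \<in> Arr C \<Longrightarrow> g \<in> Arr C \<Longrightarrow>
    Phi2 F (Cod C f, Cod C g) \<cdot>\<^bsub>D\<^esub> (arr_map F f \<otimes>\<^bsub>D\<^esub> arr_map F g)
      = arr_map F (f \<otimes>\<^bsub>C\<^esub> g) \<cdot>\<^bsub>D\<^esub> Phi2 F (Dom C f, Dom C g)"
  using nat_transf.naturality_arr [OF nat_iso.axioms(1) [OF Phi2_nat_iso], of "(f, g)"] by simp

end

lemma strong_multiplicativeI:
  assumes "semimonoidal C" "semimonoidal D" and F: "cat_functor C D F"
    and "extensional_functor C F" "Phi2 F \<in> extensional (Obj C \<times> Obj C)"
    and iso: "\<And>X Y. \<lbrakk>X \<in> Obj C; Y \<in> Obj C\<rbrakk> \<Longrightarrow>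
      iso_arr D (obj_map F X \<odot>\<^bsub>D\<^esub> obj_map F Y) (obj_map F (X \<odot>\<^bsub>C\<^esub> Y)) (Phi2 F (X, Y))"
    and nat: "\<And>f g. \<lbrakk>f \<in> Arr C; g \<in> Arr C\<rbrakk> \<Longrightarrow>
      Phi2 F (Cod C f, Cod C g) \<cdot>\<^bsub>D\<^esub> (arr_map F f \<otimes>\<^bsub>D\<^esub> arr_map F g)
        = arr_map F (f \<otimes>\<^bsub>C\<^esub> g) \<cdot>\<^bsub>D\<^esub> Phi2 F (Dom C f, Dom C g)"
    and "\<And>X Y Z. \<lbrakk>X \<in> Obj C; Y \<in> Obj C; Z \<in> Obj C\<rbrakk> \<Longrightarrow>
      Phi2 F (X \<odot>\<^bsub>C\<^esub> Y, Z) \<cdot>\<^bsub>D\<^esub> (Phi2 F (X, Y) \<otimes>\<^bsub>D\<^esub> Ide D (obj_map F Z)) =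
      Phi2 F (X, Y \<odot>\<^bsub>C\<^esub> Z) \<cdot>\<^bsub>D\<^esub> (Ide D (obj_map F X) \<otimes>\<^bsub>D\<^esub> Phi2 F (Y, Z))"
  shows "strong_multiplicative C D F"
proof -
  interpret C: semimonoidal C by fact
  interpret D: semimonoidal D by fact
  interpret cat_functor C D F by fact
  have "nat_iso (prod_cat C C) D (comp_functor (prod_cat C C) (Tens D) (prod_functor F F))
      (comp_functor (prod_cat C C) F (Tens C)) (Phi2 F)"
  proof (rule nat_isoI)
    show "cat_functor (prod_cat C C) D (comp_functor (prod_cat C C) (Tens D) (prod_functor F F))"
      by (rule cat_functor_comp [OF cat_functor_prod [OF F F] D.Tens_functor])
    show "cat_functor (prod_cat C C) D (comp_functor (prod_cat C C) F (Tens C))"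
      by (rule cat_functor_comp [OF C.Tens_functor F])
  qed (auto simp: iso nat)
  then show ?thesis
    using assms by (simp add: strong_multiplicative_def strong_multiplicative_axioms_def)
qed

text \<open>The common part of the two senses of strong monoidal functor: \<phi>_0 is invertible,
  but no equation ties it to unit constraints. It is stated over \<open>unital_cat_scheme\<close> so
  that both record types of categories are instances.\<close>

locale unital_functor = strong_multiplicative C D F + C: semimonoidal C + D: semimonoidal D
  for C :: "('o, 'm, 'y) unital_cat_scheme" and D :: "('p, 'n, 'z) unital_cat_scheme"
    and F :: "('o, 'm, 'p, 'n) mon_functor" +
  assumes source_unit [simp]: "Unit C \<in> Obj C"
    and target_unit [simp]: "Unit D \<in> Obj D"
    and unit_iso: "iso_arr D (Unit D) (obj_map F (Unit C)) (Phi0 F)"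
begin

lemmas Phi0_simps [simp] = D.iso_arrD [OF unit_iso]

text \<open>By uniqueness of the left constraint at F(X), the right-hand side \<open>?t\<close> only
  has to satisfy J \<open>?t\<close> = b F(X). Both sides are compared after composing with the
  isomorphism \<open>?h\<close>: naturality of \<phi>_2 turns I \<lambda>_X into a X, associativity
  of \<phi>_2 brings the two copies of \<phi>_0 together, the Saavedra condition replaces them by b,
  and \<open>?h\<close> is cancelled.\<close>

lemma left_unit_of_saavedra:
  assumes C: "saavedra_unit C (Unit C) a" and D: "saavedra_unit D (Unit D) b"
    and unit: "Phi0 F \<cdot>\<^bsub>D\<^esub> b
      = arr_map F a \<cdot>\<^bsub>D\<^esub> (Phi2 F (Unit C, Unit C) \<cdot>\<^bsub>D\<^esub> (Phi0 F \<otimes>\<^bsub>D\<^esub> Phi0 F))"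
    and X [simp]: "X \<in> Obj C"
  shows "left_constraint D (Unit D) b (obj_map F X)
    = arr_map F (left_constraint C (Unit C) a X) \<cdot>\<^bsub>D\<^esub>
        (Phi2 F (Unit C, X) \<cdot>\<^bsub>D\<^esub> (Phi0 F \<otimes>\<^bsub>D\<^esub> Ide D (obj_map F X)))"
proof -
  interpret CU: saavedra_unit C "Unit C" a by fact
  interpret DU: saavedra_unit D "Unit D" b by fact
  let ?I = "Unit C" and ?FX = "Ide D (obj_map F X)" and ?FI = "Ide D (obj_map F (Unit C))"
  let ?h = "Phi2 F (?I, X) \<cdot>\<^bsub>D\<^esub> (Phi0 F \<otimes>\<^bsub>D\<^esub> ?FX)"
  let ?t = "arr_map F (CU.l X) \<cdot>\<^bsub>D\<^esub> ?h"
  have h: "iso_arr D (Unit D \<odot>\<^bsub>D\<^esub> obj_map F X) (obj_map F (?I \<odot>\<^bsub>C\<^esub> X)) ?h"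
    by (rule D.iso_arr_Comp [OF D.tens_iso [OF unit_iso D.iso_arr_Ide] Phi2_iso]) simp_all
  have "?h \<cdot>\<^bsub>D\<^esub> (Ide D (Unit D) \<otimes>\<^bsub>D\<^esub> ?t)
      = (Phi2 F (?I, X) \<cdot>\<^bsub>D\<^esub> (?FI \<otimes>\<^bsub>D\<^esub> arr_map F (CU.l X))) \<cdot>\<^bsub>D\<^esub>
        ((?FI \<otimes>\<^bsub>D\<^esub> Phi2 F (?I, X)) \<cdot>\<^bsub>D\<^esub> (Phi0 F \<otimes>\<^bsub>D\<^esub> Phi0 F \<otimes>\<^bsub>D\<^esub> ?FX))"
    by simp
  also have "Phi2 F (?I, X) \<cdot>\<^bsub>D\<^esub> (?FI \<otimes>\<^bsub>D\<^esub> arr_map F (CU.l X))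
      = arr_map F (a \<otimes>\<^bsub>C\<^esub> Ide C X) \<cdot>\<^bsub>D\<^esub> Phi2 F (?I, ?I \<odot>\<^bsub>C\<^esub> X)"
    using Phi2_natural [of "Ide C ?I" "CU.l X"] by (simp add: CU.left_constraint_tens)
  also have "(arr_map F (a \<otimes>\<^bsub>C\<^esub> Ide C X) \<cdot>\<^bsub>D\<^esub> Phi2 F (?I, ?I \<odot>\<^bsub>C\<^esub> X)) \<cdot>\<^bsub>D\<^esub>
        ((?FI \<otimes>\<^bsub>D\<^esub> Phi2 F (?I, X)) \<cdot>\<^bsub>D\<^esub> (Phi0 F \<otimes>\<^bsub>D\<^esub> Phi0 F \<otimes>\<^bsub>D\<^esub> ?FX))
      = arr_map F (a \<otimes>\<^bsub>C\<^esub> Ide C X) \<cdot>\<^bsub>D\<^esub>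
        ((Phi2 F (?I, ?I \<odot>\<^bsub>C\<^esub> X) \<cdot>\<^bsub>D\<^esub> (?FI \<otimes>\<^bsub>D\<^esub> Phi2 F (?I, X))) \<cdot>\<^bsub>D\<^esub>
          (Phi0 F \<otimes>\<^bsub>D\<^esub> Phi0 F \<otimes>\<^bsub>D\<^esub> ?FX))"
    by simp
  \<comment> \<open>Rebracketing creates the factor \<open>Phi2 F (?I, ?I)\<close>, to which the
    Saavedra condition can be applied.\<close>
  also have "Phi2 F (?I, ?I \<odot>\<^bsub>C\<^esub> X) \<cdot>\<^bsub>D\<^esub> (?FI \<otimes>\<^bsub>D\<^esub> Phi2 F (?I, X))
      = Phi2 F (?I \<odot>\<^bsub>C\<^esub> ?I, X) \<cdot>\<^bsub>D\<^esub> (Phi2 F (?I, ?I) \<otimes>\<^bsub>D\<^esub> ?FX)"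
    by (simp add: Phi2_assoc)
  also have "arr_map F (a \<otimes>\<^bsub>C\<^esub> Ide C X) \<cdot>\<^bsub>D\<^esub>
        ((Phi2 F (?I \<odot>\<^bsub>C\<^esub> ?I, X) \<cdot>\<^bsub>D\<^esub> (Phi2 F (?I, ?I) \<otimes>\<^bsub>D\<^esub> ?FX)) \<cdot>\<^bsub>D\<^esub>
          (Phi0 F \<otimes>\<^bsub>D\<^esub> Phi0 F \<otimes>\<^bsub>D\<^esub> ?FX))
      = (arr_map F (a \<otimes>\<^bsub>C\<^esub> Ide C X) \<cdot>\<^bsub>D\<^esub> Phi2 F (?I \<odot>\<^bsub>C\<^esub> ?I, X)) \<cdot>\<^bsub>D\<^esub>
        ((Phi2 F (?I, ?I) \<cdot>\<^bsub>D\<^esub> (Phi0 F \<otimes>\<^bsub>D\<^esub> Phi0 F)) \<otimes>\<^bsub>D\<^esub> ?FX)"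
    by (simp del: D.tens_arr_assoc)
  also have "arr_map F (a \<otimes>\<^bsub>C\<^esub> Ide C X) \<cdot>\<^bsub>D\<^esub> Phi2 F (?I \<odot>\<^bsub>C\<^esub> ?I, X)
      = Phi2 F (?I, X) \<cdot>\<^bsub>D\<^esub> (arr_map F a \<otimes>\<^bsub>D\<^esub> ?FX)"
    using Phi2_natural [of a "Ide C X"] by simp
  also have "(Phi2 F (?I, X) \<cdot>\<^bsub>D\<^esub> (arr_map F a \<otimes>\<^bsub>D\<^esub> ?FX)) \<cdot>\<^bsub>D\<^esub>
        ((Phi2 F (?I, ?I) \<cdot>\<^bsub>D\<^esub> (Phi0 F \<otimes>\<^bsub>D\<^esub> Phi0 F)) \<otimes>\<^bsub>D\<^esub> ?FX)
      = Phi2 F (?I, X) \<cdot>\<^bsub>D\<^esub> ((Phi0 F \<cdot>\<^bsub>D\<^esub> b) \<otimes>\<^bsub>D\<^esub> ?FX)"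
    by (simp add: unit)
  also have "\<dots> = ?h \<cdot>\<^bsub>D\<^esub> (b \<otimes>\<^bsub>D\<^esub> ?FX)" by simp
  finally have "Ide D (Unit D) \<otimes>\<^bsub>D\<^esub> ?t = b \<otimes>\<^bsub>D\<^esub> ?FX"
    by (rule D.iso_arr_cancel_left [OF h, rotated 4]) simp_all
  then show ?thesis
    by (intro DU.left_constraint_eqI) simp_all
qed

text \<open>The mirror image of \<open>left_unit_of_saavedra\<close>, with associativity of \<phi>_2
  read in the opposite direction.\<close>

lemma right_unit_of_saavedra:
  assumes C: "saavedra_unit C (Unit C) a" and D: "saavedra_unit D (Unit D) b"
    and unit: "Phi0 F \<cdot>\<^bsub>D\<^esub> b
      = arr_map F a \<cdot>\<^bsub>D\<^esub> (Phi2 F (Unit C, Unit C) \<cdot>\<^bsub>D\<^esub> (Phi0 F \<otimes>\<^bsub>D\<^esub> Phi0 F))"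
    and X [simp]: "X \<in> Obj C"
  shows "right_constraint D (Unit D) b (obj_map F X)
    = arr_map F (right_constraint C (Unit C) a X) \<cdot>\<^bsub>D\<^esub>
        (Phi2 F (X, Unit C) \<cdot>\<^bsub>D\<^esub> (Ide D (obj_map F X) \<otimes>\<^bsub>D\<^esub> Phi0 F))"
proof -
  interpret CU: saavedra_unit C "Unit C" a by fact
  interpret DU: saavedra_unit D "Unit D" b by fact
  let ?I = "Unit C" and ?FX = "Ide D (obj_map F X)" and ?FI = "Ide D (obj_map F (Unit C))"
  let ?h = "Phi2 F (X, ?I) \<cdot>\<^bsub>D\<^esub> (?FX \<otimes>\<^bsub>D\<^esub> Phi0 F)"
  let ?t = "arr_map F (CU.r X) \<cdot>\<^bsub>D\<^esub> ?h"
  have h: "iso_arr D (obj_map F X \<odot>\<^bsub>D\<^esub> Unit D) (obj_map F (X \<odot>\<^bsub>C\<^esub> ?I)) ?h"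
    by (rule D.iso_arr_Comp [OF D.tens_iso [OF D.iso_arr_Ide unit_iso] Phi2_iso]) simp_all
  have "?h \<cdot>\<^bsub>D\<^esub> (?t \<otimes>\<^bsub>D\<^esub> Ide D (Unit D))
      = (Phi2 F (X, ?I) \<cdot>\<^bsub>D\<^esub> (arr_map F (CU.r X) \<otimes>\<^bsub>D\<^esub> ?FI)) \<cdot>\<^bsub>D\<^esub>
        ((Phi2 F (X, ?I) \<otimes>\<^bsub>D\<^esub> ?FI) \<cdot>\<^bsub>D\<^esub> (?FX \<otimes>\<^bsub>D\<^esub> Phi0 F \<otimes>\<^bsub>D\<^esub> Phi0 F))"
    by (simp del: D.tens_arr_assoc)
  also have "Phi2 F (X, ?I) \<cdot>\<^bsub>D\<^esub> (arr_map F (CU.r X) \<otimes>\<^bsub>D\<^esub> ?FI)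
      = arr_map F (Ide C X \<otimes>\<^bsub>C\<^esub> a) \<cdot>\<^bsub>D\<^esub> Phi2 F (X \<odot>\<^bsub>C\<^esub> ?I, ?I)"
    using Phi2_natural [of "CU.r X" "Ide C ?I"] by (simp add: CU.right_constraint_tens)
  also have "(arr_map F (Ide C X \<otimes>\<^bsub>C\<^esub> a) \<cdot>\<^bsub>D\<^esub> Phi2 F (X \<odot>\<^bsub>C\<^esub> ?I, ?I)) \<cdot>\<^bsub>D\<^esub>
        ((Phi2 F (X, ?I) \<otimes>\<^bsub>D\<^esub> ?FI) \<cdot>\<^bsub>D\<^esub> (?FX \<otimes>\<^bsub>D\<^esub> Phi0 F \<otimes>\<^bsub>D\<^esub> Phi0 F))
      = arr_map F (Ide C X \<otimes>\<^bsub>C\<^esub> a) \<cdot>\<^bsub>D\<^esub>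
        ((Phi2 F (X \<odot>\<^bsub>C\<^esub> ?I, ?I) \<cdot>\<^bsub>D\<^esub> (Phi2 F (X, ?I) \<otimes>\<^bsub>D\<^esub> ?FI)) \<cdot>\<^bsub>D\<^esub>
          (?FX \<otimes>\<^bsub>D\<^esub> Phi0 F \<otimes>\<^bsub>D\<^esub> Phi0 F))"
    by (simp del: D.tens_arr_assoc)
  also have "Phi2 F (X \<odot>\<^bsub>C\<^esub> ?I, ?I) \<cdot>\<^bsub>D\<^esub> (Phi2 F (X, ?I) \<otimes>\<^bsub>D\<^esub> ?FI)
      = Phi2 F (X, ?I \<odot>\<^bsub>C\<^esub> ?I) \<cdot>\<^bsub>D\<^esub> (?FX \<otimes>\<^bsub>D\<^esub> Phi2 F (?I, ?I))"
    by (simp add: Phi2_assoc)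
  also have "arr_map F (Ide C X \<otimes>\<^bsub>C\<^esub> a) \<cdot>\<^bsub>D\<^esub>
        ((Phi2 F (X, ?I \<odot>\<^bsub>C\<^esub> ?I) \<cdot>\<^bsub>D\<^esub> (?FX \<otimes>\<^bsub>D\<^esub> Phi2 F (?I, ?I))) \<cdot>\<^bsub>D\<^esub>
          (?FX \<otimes>\<^bsub>D\<^esub> Phi0 F \<otimes>\<^bsub>D\<^esub> Phi0 F))
      = (arr_map F (Ide C X \<otimes>\<^bsub>C\<^esub> a) \<cdot>\<^bsub>D\<^esub> Phi2 F (X, ?I \<odot>\<^bsub>C\<^esub> ?I)) \<cdot>\<^bsub>D\<^esub>
        (?FX \<otimes>\<^bsub>D\<^esub> (Phi2 F (?I, ?I) \<cdot>\<^bsub>D\<^esub> (Phi0 F \<otimes>\<^bsub>D\<^esub> Phi0 F)))"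
    by simp
  also have "arr_map F (Ide C X \<otimes>\<^bsub>C\<^esub> a) \<cdot>\<^bsub>D\<^esub> Phi2 F (X, ?I \<odot>\<^bsub>C\<^esub> ?I)
      = Phi2 F (X, ?I) \<cdot>\<^bsub>D\<^esub> (?FX \<otimes>\<^bsub>D\<^esub> arr_map F a)"
    using Phi2_natural [of "Ide C X" a] by simp
  also have "(Phi2 F (X, ?I) \<cdot>\<^bsub>D\<^esub> (?FX \<otimes>\<^bsub>D\<^esub> arr_map F a)) \<cdot>\<^bsub>D\<^esub>
        (?FX \<otimes>\<^bsub>D\<^esub> (Phi2 F (?I, ?I) \<cdot>\<^bsub>D\<^esub> (Phi0 F \<otimes>\<^bsub>D\<^esub> Phi0 F)))
      = Phi2 F (X, ?I) \<cdot>\<^bsub>D\<^esub> (?FX \<otimes>\<^bsub>D\<^esub> (Phi0 F \<cdot>\<^bsub>D\<^esub> b))"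
    by (simp add: unit)
  also have "\<dots> = ?h \<cdot>\<^bsub>D\<^esub> (?FX \<otimes>\<^bsub>D\<^esub> b)" by simp
  finally have "?t \<otimes>\<^bsub>D\<^esub> Ide D (Unit D) = ?FX \<otimes>\<^bsub>D\<^esub> b"
    by (rule D.iso_arr_cancel_left [OF h, rotated 4]) simp_all
  then show ?thesis
    by (intro DU.right_constraint_eqI) simp_all
qed

text \<open>Naturality of the target's left constraint at \<phi>_0, whose component at the unit is
  b, rewrites the left side as the constraint at F(I) after J \<phi>_0. Inserting
  \<open>unit\<close> there, (\<phi>_0 F(I)) and (J \<phi>_0) compose to \<phi>_0 \<phi>_0.\<close>

lemma saavedra_of_left_unit:
  assumes C: "saavedra_unit C (Unit C) a" and D: "saavedra_unit D (Unit D) b"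
    and unit: "left_constraint D (Unit D) b (obj_map F (Unit C))
      = arr_map F (left_constraint C (Unit C) a (Unit C)) \<cdot>\<^bsub>D\<^esub>
        (Phi2 F (Unit C, Unit C) \<cdot>\<^bsub>D\<^esub> (Phi0 F \<otimes>\<^bsub>D\<^esub> Ide D (obj_map F (Unit C))))"
  shows "Phi0 F \<cdot>\<^bsub>D\<^esub> b = arr_map F a \<cdot>\<^bsub>D\<^esub> (Phi2 F (Unit C, Unit C) \<cdot>\<^bsub>D\<^esub> (Phi0 F \<otimes>\<^bsub>D\<^esub> Phi0 F))"
proof -
  interpret CU: saavedra_unit C "Unit C" a by fact
  interpret DU: saavedra_unit D "Unit D" b by fact
  have "Phi0 F \<cdot>\<^bsub>D\<^esub> b = DU.l (obj_map F (Unit C)) \<cdot>\<^bsub>D\<^esub> (Ide D (Unit D) \<otimes>\<^bsub>D\<^esub> Phi0 F)"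
    using DU.left_constraint_natural [of "Phi0 F"] by (simp add: DU.left_constraint_unit)
  then show ?thesis
    by (simp add: unit CU.left_constraint_unit)
qed

end

section \<open>Composition of strong monoidal functors\<close>

lemma id_mon_functor_simps [simp]:
  "X \<in> Obj C \<Longrightarrow> obj_map (id_mon_functor C) X = X"
  "f \<in> Arr C \<Longrightarrow> arr_map (id_mon_functor C) f = f"
  "X \<in> Obj C \<Longrightarrow> Y \<in> Obj C \<Longrightarrow> Phi2 (id_mon_functor C) (X, Y) = Ide C (X \<odot>\<^bsub>C\<^esub> Y)"
  "Phi0 (id_mon_functor C) = Ide C (Unit C)"
  by (simp_all add: id_mon_functor_def functor_data.defs id_functor_def)

lemma extensional_id_mon_functor [simp]:
  "obj_map (id_mon_functor C) \<in> extensional (Obj C)"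
  "arr_map (id_mon_functor C) \<in> extensional (Arr C)"
  "Phi2 (id_mon_functor C) \<in> extensional (Obj C \<times> Obj C)"
  by (simp_all add: id_mon_functor_def functor_data.defs id_functor_def)

lemma comp_mon_functor_simps [simp]:
  "X \<in> Obj C \<Longrightarrow> obj_map (comp_mon_functor C E G F) X = obj_map G (obj_map F X)"
  "f \<in> Arr C \<Longrightarrow> arr_map (comp_mon_functor C E G F) f = arr_map G (arr_map F f)"
  "X \<in> Obj C \<Longrightarrow> Y \<in> Obj C \<Longrightarrow> Phi2 (comp_mon_functor C E G F) (X, Y)
    = arr_map G (Phi2 F (X, Y)) \<cdot>\<^bsub>E\<^esub> Phi2 G (obj_map F X, obj_map F Y)"
  "Phi0 (comp_mon_functor C E G F) = arr_map G (Phi0 F) \<cdot>\<^bsub>E\<^esub> Phi0 G"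
  by (simp_all add: comp_mon_functor_def functor_data.defs comp_functor_def)

lemma extensional_comp_mon_functor [simp]:
  "obj_map (comp_mon_functor C E G F) \<in> extensional (Obj C)"
  "arr_map (comp_mon_functor C E G F) \<in> extensional (Arr C)"
  "Phi2 (comp_mon_functor C E G F) \<in> extensional (Obj C \<times> Obj C)"
  by (simp_all add: comp_mon_functor_def functor_data.defs comp_functor_def)

text \<open>Strict unit and associativity laws of the 2-categories need functors to be equal as HOL
  records; extensionality reduces this to values on objects, arrows and pairs of objects.\<close>

lemma mon_functor_eqI:
  fixes F G :: "('o, 'm, 'p, 'n) mon_functor"
  assumes "obj_map F \<in> extensional (Obj C)" "obj_map G \<in> extensional (Obj C)"
    and "arr_map F \<in> extensional (Arr C)" "arr_map G \<in> extensional (Arr C)"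
    and "Phi2 F \<in> extensional (Obj C \<times> Obj C)" "Phi2 G \<in> extensional (Obj C \<times> Obj C)"
    and "\<And>X. X \<in> Obj C \<Longrightarrow> obj_map F X = obj_map G X"
    and "\<And>f. f \<in> Arr C \<Longrightarrow> arr_map F f = arr_map G f"
    and "\<And>X Y. X \<in> Obj C \<Longrightarrow> Y \<in> Obj C \<Longrightarrow> Phi2 F (X, Y) = Phi2 G (X, Y)"
    and "Phi0 F = Phi0 G"
  shows "F = G"
proof (rule mon_functor.equality)
  show "obj_map F = obj_map G" "arr_map F = arr_map G"
    using assms by (auto intro: extensionalityI)
  show "Phi2 F = Phi2 G"
    by (rule extensionalityI [OF assms(5,6)]) (use assms(9) in auto)
qed (simp_all add: assms)

context unital_functor
begin

lemma extensional_maps [simp]: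
  "obj_map F \<in> extensional (Obj C)" "arr_map F \<in> extensional (Arr C)"
  using functor_ext by (simp_all add: extensional_functor_def)

declare Phi2_ext [simp]

lemma comp_id_left: "comp_mon_functor C D (id_mon_functor D) F = F"
  by (rule mon_functor_eqI [where C = C]) simp_all

lemma comp_id_right: "comp_mon_functor C D F (id_mon_functor C) = F"
  by (rule mon_functor_eqI [where C = C]) simp_all

end

lemma unital_functorI:
  assumes "strong_multiplicative C D F" "semimonoidal C" "semimonoidal D"
    "Unit C \<in> Obj C" "Unit D \<in> Obj D" "iso_arr D (Unit D) (obj_map F (Unit C)) (Phi0 F)"
  shows "unital_functor C D F"
  using assms by (simp add: unital_functor_def unital_functor_axioms_def)

lemma unital_functor_id:
  assumes "semimonoidal C" "Unit C \<in> Obj C"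
  shows "unital_functor C C (id_mon_functor C)"
proof -
  interpret semimonoidal C by fact
  have "cat_functor C C (id_mon_functor C)"
    by (rule cat_functorI) (unfold_locales, simp_all)
  then have "strong_multiplicative C C (id_mon_functor C)"
    by (intro strong_multiplicativeI)
      (simp_all add: semimonoidal_axioms extensional_functor_def iso_arr_Ide)
  then show ?thesis
    by (rule unital_functorI) (simp_all add: assms iso_arr_Ide)
qed

lemma unital_functor_comp:
  assumes "unital_functor C D F" "unital_functor D E G"
  shows "unital_functor C E (comp_mon_functor C E G F)"
proof -
  interpret F: unital_functor C D F by fact
  interpret G: unital_functor D E G by fact
  have "cat_functor C E (comp_mon_functor C E G F)"
    by (rule cat_functorI) (unfold_locales, simp_all)
  then have "strong_multiplicative C E (comp_mon_functor C E G F)"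
  proof (rule strong_multiplicativeI [OF F.C.semimonoidal_axioms G.D.semimonoidal_axioms])
    fix X Y assume [simp]: "X \<in> Obj C" "Y \<in> Obj C"
    show "iso_arr E (obj_map (comp_mon_functor C E G F) X \<odot>\<^bsub>E\<^esub> obj_map (comp_mon_functor C E G F) Y)
      (obj_map (comp_mon_functor C E G F) (X \<odot>\<^bsub>C\<^esub> Y)) (Phi2 (comp_mon_functor C E G F) (X, Y))"
      using G.D.iso_arr_Comp [OF G.Phi2_iso G.arr_map_iso [OF F.Phi2_iso]] by simp
  next
    fix f g assume [simp]: "f \<in> Arr C" "g \<in> Arr C"
    let ?u = "arr_map G (arr_map F f)" and ?v = "arr_map G (arr_map F g)"
    have "(arr_map G (Phi2 F (Cod C f, Cod C g)) \<cdot>\<^bsub>E\<^esub>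
          Phi2 G (obj_map F (Cod C f), obj_map F (Cod C g))) \<cdot>\<^bsub>E\<^esub> (?u \<otimes>\<^bsub>E\<^esub> ?v)
        = arr_map G (Phi2 F (Cod C f, Cod C g) \<cdot>\<^bsub>D\<^esub> (arr_map F f \<otimes>\<^bsub>D\<^esub> arr_map F g)) \<cdot>\<^bsub>E\<^esub>
          Phi2 G (obj_map F (Dom C f), obj_map F (Dom C g))"
      using G.Phi2_natural [of "arr_map F f" "arr_map F g"] by simp
    also have "\<dots> = arr_map G (arr_map F (f \<otimes>\<^bsub>C\<^esub> g)) \<cdot>\<^bsub>E\<^esub> (arr_map G (Phi2 F (Dom C f, Dom C g)) \<cdot>\<^bsub>E\<^esub>
          Phi2 G (obj_map F (Dom C f), obj_map F (Dom C g)))"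
      by (simp add: F.Phi2_natural del: F.arr_map_Comp_arr)
    finally show "Phi2 (comp_mon_functor C E G F) (Cod C f, Cod C g) \<cdot>\<^bsub>E\<^esub>
        (arr_map (comp_mon_functor C E G F) f \<otimes>\<^bsub>E\<^esub> arr_map (comp_mon_functor C E G F) g)
      = arr_map (comp_mon_functor C E G F) (f \<otimes>\<^bsub>C\<^esub> g) \<cdot>\<^bsub>E\<^esub>
        Phi2 (comp_mon_functor C E G F) (Dom C f, Dom C g)"
      by simp
  next
    fix X Y Z assume [simp]: "X \<in> Obj C" "Y \<in> Obj C" "Z \<in> Obj C"
    let ?X = "obj_map F X" and ?Y = "obj_map F Y" and ?Z = "obj_map F Z"
    have "(arr_map G (Phi2 F (X \<odot>\<^bsub>C\<^esub> Y, Z)) \<cdot>\<^bsub>E\<^esub> Phi2 G (obj_map F (X \<odot>\<^bsub>C\<^esub> Y), ?Z)) \<cdot>\<^bsub>E\<^esub>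
        ((arr_map G (Phi2 F (X, Y)) \<cdot>\<^bsub>E\<^esub> Phi2 G (?X, ?Y)) \<otimes>\<^bsub>E\<^esub> Ide E (obj_map G ?Z))
      = arr_map G (Phi2 F (X \<odot>\<^bsub>C\<^esub> Y, Z)) \<cdot>\<^bsub>E\<^esub>
        ((Phi2 G (obj_map F (X \<odot>\<^bsub>C\<^esub> Y), ?Z) \<cdot>\<^bsub>E\<^esub>
          (arr_map G (Phi2 F (X, Y)) \<otimes>\<^bsub>E\<^esub> Ide E (obj_map G ?Z))) \<cdot>\<^bsub>E\<^esub>
          (Phi2 G (?X, ?Y) \<otimes>\<^bsub>E\<^esub> Ide E (obj_map G ?Z)))"
      by simp
    \<comment> \<open>Naturality of \<open>Phi2 G\<close> separates the part coming from
      \<open>F\<close> from the part coming from \<open>G\<close>, so that the two associativity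
      laws apply independently; the same exchange is then undone on the other bracketing.\<close>
    also have "\<dots> = arr_map G (Phi2 F (X \<odot>\<^bsub>C\<^esub> Y, Z) \<cdot>\<^bsub>D\<^esub> (Phi2 F (X, Y) \<otimes>\<^bsub>D\<^esub> Ide D ?Z)) \<cdot>\<^bsub>E\<^esub>
        (Phi2 G (?X \<odot>\<^bsub>D\<^esub> ?Y, ?Z) \<cdot>\<^bsub>E\<^esub> (Phi2 G (?X, ?Y) \<otimes>\<^bsub>E\<^esub> Ide E (obj_map G ?Z)))"
      using G.Phi2_natural [of "Phi2 F (X, Y)" "Ide D ?Z"] by simp
    also have "\<dots> = arr_map G (Phi2 F (X, Y \<odot>\<^bsub>C\<^esub> Z) \<cdot>\<^bsub>D\<^esub> (Ide D ?X \<otimes>\<^bsub>D\<^esub> Phi2 F (Y, Z))) \<cdot>\<^bsub>E\<^esub>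
        (Phi2 G (?X, ?Y \<odot>\<^bsub>D\<^esub> ?Z) \<cdot>\<^bsub>E\<^esub> (Ide E (obj_map G ?X) \<otimes>\<^bsub>E\<^esub> Phi2 G (?Y, ?Z)))"
      by (simp only: F.Phi2_assoc G.Phi2_assoc F.obj_map_closed \<open>X \<in> Obj C\<close> \<open>Y \<in> Obj C\<close> \<open>Z \<in> Obj C\<close>)
    also have "\<dots> = arr_map G (Phi2 F (X, Y \<odot>\<^bsub>C\<^esub> Z)) \<cdot>\<^bsub>E\<^esub>
        ((Phi2 G (?X, obj_map F (Y \<odot>\<^bsub>C\<^esub> Z)) \<cdot>\<^bsub>E\<^esub>
          (Ide E (obj_map G ?X) \<otimes>\<^bsub>E\<^esub> arr_map G (Phi2 F (Y, Z)))) \<cdot>\<^bsub>E\<^esub>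
          (Ide E (obj_map G ?X) \<otimes>\<^bsub>E\<^esub> Phi2 G (?Y, ?Z)))"
      using G.Phi2_natural [of "Ide D ?X" "Phi2 F (Y, Z)"] by simp
    also have "\<dots> = (arr_map G (Phi2 F (X, Y \<odot>\<^bsub>C\<^esub> Z)) \<cdot>\<^bsub>E\<^esub> Phi2 G (?X, obj_map F (Y \<odot>\<^bsub>C\<^esub> Z))) \<cdot>\<^bsub>E\<^esub>
        (Ide E (obj_map G ?X) \<otimes>\<^bsub>E\<^esub> (arr_map G (Phi2 F (Y, Z)) \<cdot>\<^bsub>E\<^esub> Phi2 G (?Y, ?Z)))"
      by simp
    finally show "Phi2 (comp_mon_functor C E G F) (X \<odot>\<^bsub>C\<^esub> Y, Z) \<cdot>\<^bsub>E\<^esub>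
        (Phi2 (comp_mon_functor C E G F) (X, Y) \<otimes>\<^bsub>E\<^esub> Ide E (obj_map (comp_mon_functor C E G F) Z))
      = Phi2 (comp_mon_functor C E G F) (X, Y \<odot>\<^bsub>C\<^esub> Z) \<cdot>\<^bsub>E\<^esub>
        (Ide E (obj_map (comp_mon_functor C E G F) X) \<otimes>\<^bsub>E\<^esub> Phi2 (comp_mon_functor C E G F) (Y, Z))"
      by simp
  qed (simp_all add: extensional_functor_def)
  then show ?thesis
    by (rule unital_functorI)
      (use G.D.iso_arr_Comp [OF G.unit_iso G.arr_map_iso [OF F.unit_iso]] in
        \<open>simp_all add: F.C.semimonoidal_axioms G.D.semimonoidal_axioms\<close>)
qed

lemma comp_mon_functor_assoc:
  assumes "unital_functor B C F" "unital_functor C D G" "unital_functor D E H"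
  shows "comp_mon_functor B E (comp_mon_functor C E H G) F
    = comp_mon_functor B E H (comp_mon_functor B D G F)"
proof -
  interpret F: unital_functor B C F by fact
  interpret G: unital_functor C D G by fact
  interpret H: unital_functor D E H by fact
  show ?thesis
    by (rule mon_functor_eqI [where C = B]) simp_all
qed

section \<open>The 2-category of a class of strong monoidal functors\<close>

lemma monoidal_transfI:
  assumes "cat_functor C D F" "cat_functor C D G"
    and "\<And>X. X \<in> Obj C \<Longrightarrow> u X \<in> Arr D"
    and "\<And>X. X \<in> Obj C \<Longrightarrow> Dom D (u X) = obj_map F X"
    and "\<And>X. X \<in> Obj C \<Longrightarrow> Cod D (u X) = obj_map G X"
    and "\<And>f. f \<in> Arr C \<Longrightarrow> u (Cod C f) \<cdot>\<^bsub>D\<^esub> arr_map F f = arr_map G f \<cdot>\<^bsub>D\<^esub> u (Dom C f)"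
    and "\<And>X Y. \<lbrakk>X \<in> Obj C; Y \<in> Obj C\<rbrakk> \<Longrightarrow>
      u (X \<odot>\<^bsub>C\<^esub> Y) \<cdot>\<^bsub>D\<^esub> Phi2 F (X, Y) = Phi2 G (X, Y) \<cdot>\<^bsub>D\<^esub> (u X \<otimes>\<^bsub>D\<^esub> u Y)"
    and "u (Unit C) \<cdot>\<^bsub>D\<^esub> Phi0 F = Phi0 G"
  shows "monoidal_transf C D F G u"
  using assms nat_transfI [of C D F G u]
  by (simp add: monoidal_transf_def monoidal_transf_axioms_def multiplicative_transf_def
      multiplicative_transf_axioms_def)

lemma monoidal_transf_id:
  assumes "unital_functor C D F"
  shows "monoidal_transf C D F F (\<lambda>X\<in>Obj C. Ide D (obj_map F X))"
proof -
  interpret unital_functor C D F by fact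
  show ?thesis by (rule monoidal_transfI) (unfold_locales, simp_all)
qed

lemma monoidal_transf_vcomp:
  assumes "unital_functor C D F" "unital_functor C D G" "unital_functor C D H"
    and "monoidal_transf C D F G u" "monoidal_transf C D G H v"
  shows "monoidal_transf C D F H (\<lambda>X\<in>Obj C. v X \<cdot>\<^bsub>D\<^esub> u X)"
proof -
  interpret F: unital_functor C D F by fact
  interpret G: unital_functor C D G by fact
  interpret H: unital_functor C D H by fact
  interpret u: monoidal_transf C D F G u by fact
  interpret v: monoidal_transf C D G H v by fact
  show ?thesis
  proof (rule monoidal_transfI)
    fix f assume [simp]: "f \<in> Arr C"
    show "(\<lambda>X\<in>Obj C. v X \<cdot>\<^bsub>D\<^esub> u X) (Cod C f) \<cdot>\<^bsub>D\<^esub> arr_map F f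
        = arr_map H f \<cdot>\<^bsub>D\<^esub> (\<lambda>X\<in>Obj C. v X \<cdot>\<^bsub>D\<^esub> u X) (Dom C f)"
      using F.D.Comp_reassoc [OF v.naturality_arr, of f "u (Dom C f)"]
      by (simp add: u.naturality_arr)
  next
    fix X Y assume [simp]: "X \<in> Obj C" "Y \<in> Obj C"
    show "(\<lambda>X\<in>Obj C. v X \<cdot>\<^bsub>D\<^esub> u X) (X \<odot>\<^bsub>C\<^esub> Y) \<cdot>\<^bsub>D\<^esub> Phi2 F (X, Y)
      = Phi2 H (X, Y) \<cdot>\<^bsub>D\<^esub> ((\<lambda>X\<in>Obj C. v X \<cdot>\<^bsub>D\<^esub> u X) X \<otimes>\<^bsub>D\<^esub> (\<lambda>X\<in>Obj C. v X \<cdot>\<^bsub>D\<^esub> u X) Y)"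
      using F.D.Comp_reassoc [OF v.multiplicative, of X Y "u X \<otimes>\<^bsub>D\<^esub> u Y"]
      by (simp add: u.multiplicative)
  next
    show "(\<lambda>X\<in>Obj C. v X \<cdot>\<^bsub>D\<^esub> u X) (Unit C) \<cdot>\<^bsub>D\<^esub> Phi0 F = Phi0 H"
      by (simp add: u.unit_compatible v.unit_compatible)
  qed (unfold_locales, simp_all)
qed

text \<open>For multiplicativity, the image under \<open>G\<close> of the square for
  \<open>u\<close> is pasted with naturality of \<open>v\<close> at \<open>Phi2 F' (X, Y)\<close>,
  naturality of \<open>Phi2 G\<close> at the components of \<open>u\<close>, and the multiplicative
  square of \<open>v\<close>. Unit compatibility is the same pasting with \<phi>_0 in place of
  \<phi>_2.\<close>

lemma monoidal_transf_hcomp: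
  assumes "unital_functor C D F" "unital_functor C D F'"
    and "unital_functor D E G" "unital_functor D E G'"
    and "monoidal_transf C D F F' u" "monoidal_transf D E G G' v"
  shows "monoidal_transf C E (comp_mon_functor C E G F) (comp_mon_functor C E G' F')
    (\<lambda>X\<in>Obj C. v (obj_map F' X) \<cdot>\<^bsub>E\<^esub> arr_map G (u X))"
proof -
  interpret F: unital_functor C D F by fact
  interpret F': unital_functor C D F' by fact
  interpret G: unital_functor D E G by fact
  interpret G': unital_functor D E G' by fact
  interpret u: monoidal_transf C D F F' u by fact
  interpret v: monoidal_transf D E G G' v by fact
  interpret GF: unital_functor C E "comp_mon_functor C E G F"
    by (rule unital_functor_comp) fact+
  interpret GF': unital_functor C E "comp_mon_functor C E G' F'"
    by (rule unital_functor_comp) fact+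
  let ?w = "\<lambda>X\<in>Obj C. v (obj_map F' X) \<cdot>\<^bsub>E\<^esub> arr_map G (u X)"
  show ?thesis
  proof (rule monoidal_transfI)
    fix f assume [simp]: "f \<in> Arr C"
    have "?w (Cod C f) \<cdot>\<^bsub>E\<^esub> arr_map G (arr_map F f)
      = v (obj_map F' (Cod C f)) \<cdot>\<^bsub>E\<^esub> arr_map G (u (Cod C f) \<cdot>\<^bsub>D\<^esub> arr_map F f)"
      by simp
    also have "\<dots> = (v (obj_map F' (Cod C f)) \<cdot>\<^bsub>E\<^esub> arr_map G (arr_map F' f)) \<cdot>\<^bsub>E\<^esub>
        arr_map G (u (Dom C f))"
      unfolding u.naturality_arr [OF \<open>f \<in> Arr C\<close>] by simp
    also have "\<dots> = arr_map G' (arr_map F' f) \<cdot>\<^bsub>E\<^esub> ?w (Dom C f)"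
      using v.naturality_arr [of "arr_map F' f"] by simp
    finally show "?w (Cod C f) \<cdot>\<^bsub>E\<^esub> arr_map (comp_mon_functor C E G F) f
        = arr_map (comp_mon_functor C E G' F') f \<cdot>\<^bsub>E\<^esub> ?w (Dom C f)"
      by simp
  next
    fix X Y assume [simp]: "X \<in> Obj C" "Y \<in> Obj C"
    let ?x = "obj_map F' X" and ?y = "obj_map F' Y" and ?xy = "obj_map F' (X \<odot>\<^bsub>C\<^esub> Y)"
    have "?w (X \<odot>\<^bsub>C\<^esub> Y) \<cdot>\<^bsub>E\<^esub> (arr_map G (Phi2 F (X, Y)) \<cdot>\<^bsub>E\<^esub> Phi2 G (obj_map F X, obj_map F Y))
        = v ?xy \<cdot>\<^bsub>E\<^esub> (arr_map G (u (X \<odot>\<^bsub>C\<^esub> Y) \<cdot>\<^bsub>D\<^esub> Phi2 F (X, Y)) \<cdot>\<^bsub>E\<^esub>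
          Phi2 G (obj_map F X, obj_map F Y))"
      by simp
    also have "\<dots> = (v ?xy \<cdot>\<^bsub>E\<^esub> arr_map G (Phi2 F' (X, Y))) \<cdot>\<^bsub>E\<^esub>
        (arr_map G (u X \<otimes>\<^bsub>D\<^esub> u Y) \<cdot>\<^bsub>E\<^esub> Phi2 G (obj_map F X, obj_map F Y))"
      unfolding u.multiplicative [OF \<open>X \<in> Obj C\<close> \<open>Y \<in> Obj C\<close>] by simp
    also have "v ?xy \<cdot>\<^bsub>E\<^esub> arr_map G (Phi2 F' (X, Y))
        = arr_map G' (Phi2 F' (X, Y)) \<cdot>\<^bsub>E\<^esub> v (?x \<odot>\<^bsub>D\<^esub> ?y)"
      using v.naturality_arr [of "Phi2 F' (X, Y)"] by simp
    also have "arr_map G (u X \<otimes>\<^bsub>D\<^esub> u Y) \<cdot>\<^bsub>E\<^esub> Phi2 G (obj_map F X, obj_map F Y)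
        = Phi2 G (?x, ?y) \<cdot>\<^bsub>E\<^esub> (arr_map G (u X) \<otimes>\<^bsub>E\<^esub> arr_map G (u Y))"
      using G.Phi2_natural [of "u X" "u Y"] by simp
    also have "(arr_map G' (Phi2 F' (X, Y)) \<cdot>\<^bsub>E\<^esub> v (?x \<odot>\<^bsub>D\<^esub> ?y)) \<cdot>\<^bsub>E\<^esub>
          (Phi2 G (?x, ?y) \<cdot>\<^bsub>E\<^esub> (arr_map G (u X) \<otimes>\<^bsub>E\<^esub> arr_map G (u Y)))
        = arr_map G' (Phi2 F' (X, Y)) \<cdot>\<^bsub>E\<^esub>
          ((v (?x \<odot>\<^bsub>D\<^esub> ?y) \<cdot>\<^bsub>E\<^esub> Phi2 G (?x, ?y)) \<cdot>\<^bsub>E\<^esub> (arr_map G (u X) \<otimes>\<^bsub>E\<^esub> arr_map G (u Y)))"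
      by simp
    also have "\<dots> = (arr_map G' (Phi2 F' (X, Y)) \<cdot>\<^bsub>E\<^esub> Phi2 G' (?x, ?y)) \<cdot>\<^bsub>E\<^esub> (?w X \<otimes>\<^bsub>E\<^esub> ?w Y)"
      by (simp add: v.multiplicative)
    finally show "?w (X \<odot>\<^bsub>C\<^esub> Y) \<cdot>\<^bsub>E\<^esub> Phi2 (comp_mon_functor C E G F) (X, Y)
        = Phi2 (comp_mon_functor C E G' F') (X, Y) \<cdot>\<^bsub>E\<^esub> (?w X \<otimes>\<^bsub>E\<^esub> ?w Y)"
      by simp
  next
    have "?w (Unit C) \<cdot>\<^bsub>E\<^esub> (arr_map G (Phi0 F) \<cdot>\<^bsub>E\<^esub> Phi0 G)
        = v (obj_map F' (Unit C)) \<cdot>\<^bsub>E\<^esub> (arr_map G (u (Unit C) \<cdot>\<^bsub>D\<^esub> Phi0 F) \<cdot>\<^bsub>E\<^esub> Phi0 G)"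
      by simp
    also have "\<dots> = (v (obj_map F' (Unit C)) \<cdot>\<^bsub>E\<^esub> arr_map G (Phi0 F')) \<cdot>\<^bsub>E\<^esub> Phi0 G"
      unfolding u.unit_compatible by simp
    also have "\<dots> = arr_map G' (Phi0 F') \<cdot>\<^bsub>E\<^esub> Phi0 G'"
      using v.naturality_arr [of "Phi0 F'"] by (simp add: v.unit_compatible)
    finally show "?w (Unit C) \<cdot>\<^bsub>E\<^esub> Phi0 (comp_mon_functor C E G F) = Phi0 (comp_mon_functor C E G' F')"
      by simp
  qed (unfold_locales, simp_all)
qed

section \<open>Strict laws for 2-cells\<close>

lemma transf_eqI:
  fixes u v :: "('o, 'm, 'p, 'n) transf"
  assumes "Src u = Src v" "Tgt u = Tgt v" "Cmp u \<in> extensional A" "Cmp v \<in> extensional A"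
    and "\<And>X. X \<in> A \<Longrightarrow> Cmp u X = Cmp v X"
  shows "u = v"
  by (rule transf.equality) (use assms in \<open>auto intro: extensionalityI\<close>)

lemma id_transf_simps [simp]:
  "Src (id_transf C D F) = F" "Tgt (id_transf C D F) = F"
  "Cmp (id_transf C D F) = (\<lambda>X\<in>Obj C. Ide D (obj_map F X))"
  by (simp_all add: id_transf_def)

lemma vcomp_transf_simps [simp]:
  "Src (vcomp_transf C D v u) = Src u" "Tgt (vcomp_transf C D v u) = Tgt v"
  "Cmp (vcomp_transf C D v u) = (\<lambda>X\<in>Obj C. Cmp v X \<cdot>\<^bsub>D\<^esub> Cmp u X)"
  by (simp_all add: vcomp_transf_def)

lemma hcomp_transf_simps [simp]:
  "Src (hcomp_transf C E v u) = comp_mon_functor C E (Src v) (Src u)"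
  "Tgt (hcomp_transf C E v u) = comp_mon_functor C E (Tgt v) (Tgt u)"
  "Cmp (hcomp_transf C E v u)
    = (\<lambda>X\<in>Obj C. Cmp v (obj_map (Tgt u) X) \<cdot>\<^bsub>E\<^esub> arr_map (Src v) (Cmp u X))"
  by (simp_all add: hcomp_transf_def)

lemma mon_hom_cat_simps [simp]:
  "Obj (mon_hom_cat P C D) = {F. P C D F}"
  "Dom (mon_hom_cat P C D) = Src"
  "Cod (mon_hom_cat P C D) = Tgt"
  "Ide (mon_hom_cat P C D) = id_transf C D"
  "Comp (mon_hom_cat P C D) = vcomp_transf C D"
  by (simp_all add: mon_hom_cat_def)

lemma mon_two_cat_simps [simp]:
  "Cell0 (mon_two_cat S P) = S"
  "HomCat (mon_two_cat S P) = mon_hom_cat P"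
  "Id1 (mon_two_cat S P) = id_mon_functor"
  "hcomp1 (mon_two_cat S P) C D E G F = comp_mon_functor C E G F"
  "hcomp2 (mon_two_cat S P) C D E v u = hcomp_transf C E v u"
  by (simp_all add: mon_two_cat_def)

text \<open>A 2-cell whose endpoints are only required to be unital functors. The laws of horizontal
  composition can thus be proved before a class of functors is fixed.\<close>

locale mon_transf_cell = F: unital_functor C D "Src u" + G: unital_functor C D "Tgt u" +
    monoidal_transf C D "Src u" "Tgt u" "Cmp u"
  for C :: "('o, 'm, 'z) unital_cat_scheme" and D :: "('p, 'n, 'y) unital_cat_scheme"
    and u :: "('o, 'm, 'p, 'n) transf" +
  assumes Cmp_ext [simp]: "Cmp u \<in> extensional (Obj C)"

lemma hcomp_transf_id:
  assumes "unital_functor C D F" "unital_functor D E G"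
  shows "hcomp_transf C E (id_transf D E G) (id_transf C D F) = id_transf C E (comp_mon_functor C E G F)"
proof -
  interpret F: unital_functor C D F by fact
  interpret G: unital_functor D E G by fact
  show ?thesis by (rule transf_eqI [where A = "Obj C"]) simp_all
qed

text \<open>The interchange law. At \<open>X\<close> the two composites differ by one naturality
  square of \<open>v\<close>, taken at the component \<open>Cmp u' X\<close>.\<close>

lemma hcomp_vcomp_transf:
  assumes "mon_transf_cell C D u" "mon_transf_cell C D u'" "Tgt u = Src u'"
    and "mon_transf_cell D E v" "mon_transf_cell D E v'" "Tgt v = Src v'"
  shows "hcomp_transf C E (vcomp_transf D E v' v) (vcomp_transf C D u' u)
    = vcomp_transf C E (hcomp_transf C E v' u') (hcomp_transf C E v u)"
proof -
  interpret u: mon_transf_cell C D u by fact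
  interpret u': mon_transf_cell C D u' by fact
  interpret v: mon_transf_cell D E v by fact
  interpret v': mon_transf_cell D E v' by fact
  note [simp] = \<open>Tgt u = Src u'\<close> \<open>Tgt v = Src v'\<close>
  show ?thesis
  proof (rule transf_eqI [where A = "Obj C"])
    fix X assume [simp]: "X \<in> Obj C"
    show "Cmp (hcomp_transf C E (vcomp_transf D E v' v) (vcomp_transf C D u' u)) X
        = Cmp (vcomp_transf C E (hcomp_transf C E v' u') (hcomp_transf C E v u)) X"
      using v.F.D.Comp_reassoc [OF v.naturality_arr [of "Cmp u' X"],
          of "arr_map (Src v) (Cmp u X)"]
      by simp
  qed simp_all
qed

lemma hcomp_transf_assoc:
  assumes "mon_transf_cell A B u" "mon_transf_cell B C v" "mon_transf_cell C D w"
  shows "hcomp_transf A D (hcomp_transf B D w v) u = hcomp_transf A D w (hcomp_transf A C v u)"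
proof -
  interpret u: mon_transf_cell A B u by fact
  interpret v: mon_transf_cell B C v by fact
  interpret w: mon_transf_cell C D w by fact
  show ?thesis
  proof (rule transf_eqI [where A = "Obj A"])
    show "Src (hcomp_transf A D (hcomp_transf B D w v) u) = Src (hcomp_transf A D w (hcomp_transf A C v u))"
      "Tgt (hcomp_transf A D (hcomp_transf B D w v) u) = Tgt (hcomp_transf A D w (hcomp_transf A C v u))"
      by (simp_all add: comp_mon_functor_assoc u.F.unital_functor_axioms v.F.unital_functor_axioms
          w.F.unital_functor_axioms u.G.unital_functor_axioms v.G.unital_functor_axioms
          w.G.unital_functor_axioms)
  qed simp_all
qed

text \<open>The 2-category structure does not depend on which unit compatibility \<open>P\<close> encodes.\<close>

locale mon_functor_class =
  fixes S :: "('o, 'm, 'z) unital_cat_scheme set"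
    and P :: "('o, 'm, 'z) unital_cat_scheme \<Rightarrow> ('o, 'm, 'z) unital_cat_scheme
      \<Rightarrow> ('o, 'm, 'o, 'm) mon_functor \<Rightarrow> bool"
  assumes P_unital: "\<lbrakk>C \<in> S; D \<in> S; P C D F\<rbrakk> \<Longrightarrow> unital_functor C D F"
    and P_id: "C \<in> S \<Longrightarrow> P C C (id_mon_functor C)"
    and P_comp: "\<lbrakk>C \<in> S; D \<in> S; E \<in> S; P C D F; P D E G\<rbrakk> \<Longrightarrow> P C E (comp_mon_functor C E G F)"
begin

lemma Arr_mon_hom_cat:
  assumes "C \<in> S" "D \<in> S"
  shows "u \<in> Arr (mon_hom_cat P C D) \<longleftrightarrow> P C D (Src u) \<and> P C D (Tgt u) \<and> mon_transf_cell C D u"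
  using assms P_unital [of C D]
  by (auto simp: mon_hom_cat_def mon_transf_cell_def mon_transf_cell_axioms_def)

lemma mon_transf_cell_id:
  assumes "C \<in> S" "D \<in> S" "P C D F"
  shows "mon_transf_cell C D (id_transf C D F)"
  using P_unital [OF assms] monoidal_transf_id [OF P_unital [OF assms]]
  by (simp add: mon_transf_cell_def mon_transf_cell_axioms_def)

lemma category_mon_hom_cat:
  assumes S: "C \<in> S" "D \<in> S"
  shows "category (mon_hom_cat P C D)"
proof
  show "Dom (mon_hom_cat P C D) u \<in> Obj (mon_hom_cat P C D)"
    "Cod (mon_hom_cat P C D) u \<in> Obj (mon_hom_cat P C D)"
    if "u \<in> Arr (mon_hom_cat P C D)" for u
    using that by (simp_all add: Arr_mon_hom_cat [OF S])
  show "Ide (mon_hom_cat P C D) F \<in> hom (mon_hom_cat P C D) F F"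
    if "F \<in> Obj (mon_hom_cat P C D)" for F
    using that mon_transf_cell_id [OF S] by (simp add: hom_def Arr_mon_hom_cat [OF S])
  show "v \<cdot>\<^bsub>mon_hom_cat P C D\<^esub> u \<in> hom (mon_hom_cat P C D) F H"
    if "u \<in> hom (mon_hom_cat P C D) F G" "v \<in> hom (mon_hom_cat P C D) G H" for u v F G H
    using that monoidal_transf_vcomp [of C D F G H "Cmp u" "Cmp v"]
    by (auto simp: hom_def Arr_mon_hom_cat [OF S] mon_transf_cell_def mon_transf_cell_axioms_def)
  fix F G u assume u: "u \<in> hom (mon_hom_cat P C D) F G"
  then interpret u: mon_transf_cell C D u
    by (simp add: hom_def Arr_mon_hom_cat [OF S])
  show "Ide (mon_hom_cat P C D) G \<cdot>\<^bsub>mon_hom_cat P C D\<^esub> u = u"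
    "u \<cdot>\<^bsub>mon_hom_cat P C D\<^esub> Ide (mon_hom_cat P C D) F = u"
    by (rule transf_eqI [where A = "Obj C"]; use u in \<open>force simp: hom_def\<close>)+
next
  fix F G H K u v w
  assume uvw: "u \<in> hom (mon_hom_cat P C D) F G" "v \<in> hom (mon_hom_cat P C D) G H"
    "w \<in> hom (mon_hom_cat P C D) H K"
  then interpret u: mon_transf_cell C D u by (simp add: hom_def Arr_mon_hom_cat [OF S])
  from uvw interpret v: mon_transf_cell C D v by (simp add: hom_def Arr_mon_hom_cat [OF S])
  from uvw interpret w: mon_transf_cell C D w by (simp add: hom_def Arr_mon_hom_cat [OF S])
  show "(w \<cdot>\<^bsub>mon_hom_cat P C D\<^esub> v) \<cdot>\<^bsub>mon_hom_cat P C D\<^esub> u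
      = w \<cdot>\<^bsub>mon_hom_cat P C D\<^esub> (v \<cdot>\<^bsub>mon_hom_cat P C D\<^esub> u)"
    by (rule transf_eqI [where A = "Obj C"]) (use uvw in \<open>simp_all add: hom_def\<close>)
qed

lemma mon_transf_cell_hcomp:
  assumes "mon_transf_cell C D u" "mon_transf_cell D E v"
  shows "mon_transf_cell C E (hcomp_transf C E v u)"
  using assms monoidal_transf_hcomp [of C D "Src u" "Tgt u" E "Src v" "Tgt v" "Cmp u" "Cmp v"]
  by (auto simp: mon_transf_cell_def mon_transf_cell_axioms_def intro: unital_functor_comp)

lemma cat_functor_hcomp:
  assumes S: "C \<in> S" "D \<in> S" "E \<in> S"
  shows "cat_functor (prod_cat (mon_hom_cat P D E) (mon_hom_cat P C D)) (mon_hom_cat P C E)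
    (HComp (mon_two_cat S P) C D E)"
proof (rule cat_functorI)
  show "category (prod_cat (mon_hom_cat P D E) (mon_hom_cat P C D))" "category (mon_hom_cat P C E)"
    by (simp_all add: category_prod_cat category_mon_hom_cat S)
qed (auto simp: Arr_mon_hom_cat S P_unital mon_transf_cell_hcomp hcomp_transf_id hcomp_vcomp_transf
    intro: P_comp [OF S])

lemma two_category_mon_two_cat: "two_category (mon_two_cat S P)"
proof (rule two_category.intro, unfold mon_two_cat_simps)
  show "category (mon_hom_cat P A B)" if "A \<in> S" "B \<in> S" for A B
    using that by (rule category_mon_hom_cat)
  show "id_mon_functor A \<in> Obj (mon_hom_cat P A A)" if "A \<in> S" for A
    using that by (simp add: P_id)
  show "cat_functor (prod_cat (mon_hom_cat P B C) (mon_hom_cat P A B)) (mon_hom_cat P A C)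
      (HComp (mon_two_cat S P) A B C)" if "A \<in> S" "B \<in> S" "C \<in> S" for A B C
    using that by (rule cat_functor_hcomp)
next
  fix A B C D f g h
  assume "A \<in> S" "B \<in> S" "C \<in> S" "D \<in> S" "f \<in> Obj (mon_hom_cat P A B)"
    "g \<in> Obj (mon_hom_cat P B C)" "h \<in> Obj (mon_hom_cat P C D)"
  then show "comp_mon_functor A D (comp_mon_functor B D h g) f
      = comp_mon_functor A D h (comp_mon_functor A C g f)"
    by (intro comp_mon_functor_assoc) (simp_all add: P_unital)
next
  fix A B C D u v w
  assume "A \<in> S" "B \<in> S" "C \<in> S" "D \<in> S" "u \<in> Arr (mon_hom_cat P A B)"
    "v \<in> Arr (mon_hom_cat P B C)" "w \<in> Arr (mon_hom_cat P C D)"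
  then show "hcomp_transf A D (hcomp_transf B D w v) u = hcomp_transf A D w (hcomp_transf A C v u)"
    by (intro hcomp_transf_assoc) (simp_all add: Arr_mon_hom_cat)
next
  fix A B f assume "A \<in> S" "B \<in> S" "f \<in> Obj (mon_hom_cat P A B)"
  then interpret unital_functor A B f by (simp add: P_unital)
  show "comp_mon_functor A B (id_mon_functor B) f = f" "comp_mon_functor A B f (id_mon_functor A) = f"
    by (rule comp_id_left comp_id_right)+
next
  fix A B u assume "A \<in> S" "B \<in> S" "u \<in> Arr (mon_hom_cat P A B)"
  then interpret mon_transf_cell A B u by (simp add: Arr_mon_hom_cat)
  show "hcomp_transf A B (Ide (mon_hom_cat P B B) (id_mon_functor B)) u = u"
    by (rule transf_eqI [where A = "Obj A"]) (simp_all add: F.comp_id_left G.comp_id_left)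
  show "hcomp_transf A B u (Ide (mon_hom_cat P A A) (id_mon_functor A)) = u"
    by (rule transf_eqI [where A = "Obj A"]) (simp_all add: F.comp_id_right G.comp_id_right)
qed

end

section \<open>Composition of functors in the Saavedra-unit sense\<close>

lemma semimonoidal_saavedra: "saavedra_monoidal C \<Longrightarrow> semimonoidal C"
  by (simp add: saavedra_monoidal_def saavedra_unit_def)

lemma saavedra_unital:
  assumes "saavedra_monoidal C" "saavedra_monoidal D" "saavedra_strong_monoidal C D F"
  shows "unital_functor C D F"
proof -
  interpret saavedra_strong_monoidal C D F by fact
  have "Unit C \<in> Obj C" "Unit D \<in> Obj D"
    using assms by (simp_all add: saavedra_monoidal_def saavedra_unit.unit_obj)
  then show ?thesis
    by (intro unital_functorI)
      (simp_all add: strong_multiplicative_axioms Phi0_iso semimonoidal_saavedra assms)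
qed

lemma saavedra_strong_monoidal_id:
  assumes "saavedra_monoidal C"
  shows "saavedra_strong_monoidal C C (id_mon_functor C)"
proof -
  interpret saavedra_unit C "Unit C" "Alpha C"
    using assms by (simp add: saavedra_monoidal_def)
  interpret I: unital_functor C C "id_mon_functor C"
    by (rule unital_functor_id) (simp_all add: semimonoidal_axioms)
  show ?thesis
    by (intro saavedra_strong_monoidal.intro saavedra_strong_monoidal_axioms.intro
        I.strong_multiplicative_axioms I.unit_iso) simp
qed

text \<open>The unit square of \<open>G\<close> is pasted with the image under \<open>G\<close> of
  the unit square of \<open>F\<close>; naturality of \<open>Phi2 G\<close> at the pair (\<phi>_0,
  \<phi>_0) joins them.\<close>

lemma saavedra_strong_monoidal_comp:
  assumes "saavedra_monoidal C" "saavedra_monoidal D" "saavedra_monoidal E"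
    and F: "saavedra_strong_monoidal C D F" and G: "saavedra_strong_monoidal D E G"
  shows "saavedra_strong_monoidal C E (comp_mon_functor C E G F)"
proof -
  interpret F: unital_functor C D F using assms by (intro saavedra_unital)
  interpret G: unital_functor D E G using assms by (intro saavedra_unital)
  interpret GF: unital_functor C E "comp_mon_functor C E G F"
    by (rule unital_functor_comp) unfold_locales
  interpret CU: saavedra_unit C "Unit C" "Alpha C"
    using assms by (simp add: saavedra_monoidal_def)
  interpret DU: saavedra_unit D "Unit D" "Alpha D"
    using assms by (simp add: saavedra_monoidal_def)
  interpret EU: saavedra_unit E "Unit E" "Alpha E"
    using assms by (simp add: saavedra_monoidal_def)
  note F0 = saavedra_strong_monoidal.Phi0_Alpha [OF F]
    and G0 = saavedra_strong_monoidal.Phi0_Alpha [OF G]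
  let ?I = "Unit C" and ?FI = "obj_map F (Unit C)"
  have "(arr_map G (Phi0 F) \<cdot>\<^bsub>E\<^esub> Phi0 G) \<cdot>\<^bsub>E\<^esub> Alpha E
      = arr_map G (Phi0 F \<cdot>\<^bsub>D\<^esub> Alpha D) \<cdot>\<^bsub>E\<^esub>
        (Phi2 G (Unit D, Unit D) \<cdot>\<^bsub>E\<^esub> (Phi0 G \<otimes>\<^bsub>E\<^esub> Phi0 G))"
    by (simp add: G0)
  also have "\<dots> = arr_map G (arr_map F (Alpha C)) \<cdot>\<^bsub>E\<^esub> (arr_map G (Phi2 F (?I, ?I)) \<cdot>\<^bsub>E\<^esub>
      ((arr_map G (Phi0 F \<otimes>\<^bsub>D\<^esub> Phi0 F) \<cdot>\<^bsub>E\<^esub> Phi2 G (Unit D, Unit D)) \<cdot>\<^bsub>E\<^esub>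
        (Phi0 G \<otimes>\<^bsub>E\<^esub> Phi0 G)))"
    unfolding F0 by simp
  also have "arr_map G (Phi0 F \<otimes>\<^bsub>D\<^esub> Phi0 F) \<cdot>\<^bsub>E\<^esub> Phi2 G (Unit D, Unit D)
      = Phi2 G (?FI, ?FI) \<cdot>\<^bsub>E\<^esub> (arr_map G (Phi0 F) \<otimes>\<^bsub>E\<^esub> arr_map G (Phi0 F))"
    using G.Phi2_natural [of "Phi0 F" "Phi0 F"] by simp
  finally show ?thesis
    by (intro saavedra_strong_monoidal.intro saavedra_strong_monoidal_axioms.intro
        GF.strong_multiplicative_axioms GF.unit_iso) simp
qed

lemma mon_functor_class_saavedra:
  "mon_functor_class {C. saavedra_monoidal C} saavedra_strong_monoidal"
  by (rule mon_functor_class.intro)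
    (auto intro: saavedra_unital saavedra_strong_monoidal_id saavedra_strong_monoidal_comp)

section \<open>Invariance under change of the chosen unit data\<close>

text \<open>
  A category with LR unit and its associated category with Saavedra unit live in different record
  types; equality of their truncations says that they have the same underlying unital category.
\<close>

lemma cat_truncate_eqD:
  assumes "cat.truncate C = cat.truncate C'"
  shows "Obj C = Obj C'" "Arr C = Arr C'" "Dom C = Dom C'" "Cod C = Cod C'" "Ide C = Ide C'"
    "Comp C = Comp C'"
  using assms by (simp_all add: cat.defs)

text \<open>Each of these notions inspects a record only through the fields that truncation keeps,
  so unfolding it and rewriting those fields suffices.\<close>

lemma cat_truncate_cong:
  assumes C: "cat.truncate C = cat.truncate C'" and D: "cat.truncate D = cat.truncate D'"
  shows "hom C = hom C'" "category C = category C'" "iso_arr C = iso_arr C'"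
    "cat_functor C D F = cat_functor C' D' F" "nat_transf C D F G u = nat_transf C' D' F G u"
    "nat_iso C D F G u = nat_iso C' D' F G u" "fully_faithful C D F = fully_faithful C' D' F"
    "prod_cat C D = prod_cat C' D'"
    "id_functor C = id_functor C'" "comp_functor C K H = comp_functor C' K H"
    "extensional_cat C = extensional_cat C'" "extensional_functor C F = extensional_functor C' F"
proof -
  note eqs = cat_truncate_eqD [OF C] cat_truncate_eqD [OF D]
  show hom: "hom C = hom C'" by (simp add: fun_eq_iff hom_def eqs)
  have hom': "hom D = hom D'" by (simp add: fun_eq_iff hom_def eqs)
  show cat: "category C = category C'"
    by (simp add: category_def eqs hom)
  have cat': "category D = category D'"
    by (simp add: category_def eqs hom')
  show "iso_arr C = iso_arr C'"
    by (simp add: fun_eq_iff iso_arr_def eqs hom)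
  have iso': "iso_arr D = iso_arr D'"
    by (simp add: fun_eq_iff iso_arr_def eqs hom')
  show func: "cat_functor C D F = cat_functor C' D' F" for F
    by (simp add: cat_functor_def cat_functor_axioms_def eqs hom hom' cat cat')
  show nt: "nat_transf C D F G u = nat_transf C' D' F G u"
    by (simp add: nat_transf_def nat_transf_axioms_def eqs hom hom' func)
  show "nat_iso C D F G u = nat_iso C' D' F G u"
    by (simp add: nat_iso_def nat_iso_axioms_def eqs iso' nt)
  show "fully_faithful C D F = fully_faithful C' D' F"
    by (simp add: fully_faithful_def eqs hom hom' func)
qed (simp_all add: prod_cat_def id_functor_def comp_functor_def extensional_cat_def
    extensional_functor_def cat_truncate_eqD [OF C] cat_truncate_eqD [OF D])

lemma truncate_eqD:
  assumes "unital_cat.truncate C = unital_cat.truncate C'"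
  shows "cat.truncate C = cat.truncate C'" "Obj C = Obj C'" "Arr C = Arr C'" "Dom C = Dom C'"
    "Cod C = Cod C'" "Ide C = Ide C'" "Comp C = Comp C'" "Tens C = Tens C'" "Unit C = Unit C'"
  using assms by (simp_all add: unital_cat.defs cat.defs)

lemma truncate_cong:
  assumes C: "unital_cat.truncate C = unital_cat.truncate C'"
  shows "semimonoidal C = semimonoidal C'" "saavedra_unit C = saavedra_unit C'"
    "lr_unit C = lr_unit C'" "left_constraint C = left_constraint C'"
    "right_constraint C = right_constraint C'" "id_mon_functor C = id_mon_functor C'"
proof -
  note eqs = truncate_eqD [OF C]
  note cong = cat_truncate_cong [OF eqs(1) eqs(1)]
  \<comment> \<open>Rewriting replaces the product category first, which leaves a mixed statement
    where only the target still has to change.\<close>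
  have cong2: "cat_functor (prod_cat C' C') C F = cat_functor (prod_cat C' C') C' F" for F
    by (rule cat_truncate_cong(4)) (simp_all add: eqs)
  have tens: "tens_left C = tens_left C'" "tens_right C = tens_right C'"
    by (simp_all add: fun_eq_iff tens_left_def tens_right_def eqs)
  show semi: "semimonoidal C = semimonoidal C'"
    by (simp add: semimonoidal_def semimonoidal_axioms_def eqs cong cong2)
  have "cancellable C = cancellable C'"
    by (simp add: fun_eq_iff cancellable_def eqs cong tens)
  then show "saavedra_unit C = saavedra_unit C'"
    by (simp add: fun_eq_iff saavedra_unit_def saavedra_unit_axioms_def semi eqs cong)
  show "lr_unit C = lr_unit C'"
    by (simp add: fun_eq_iff lr_unit_def lr_unit_axioms_def semi eqs cong tens)
  show "left_constraint C = left_constraint C'" "right_constraint C = right_constraint C'"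
    by (simp_all add: fun_eq_iff left_constraint_def right_constraint_def eqs cong)
  show "id_mon_functor C = id_mon_functor C'"
    by (simp add: id_mon_functor_def eqs cong)
qed

lemma truncate_cong2:
  assumes C: "unital_cat.truncate C = unital_cat.truncate C'"
    and D: "unital_cat.truncate D = unital_cat.truncate D'"
  shows "strong_multiplicative C D F = strong_multiplicative C' D' F"
    "monoidal_transf C D F G u = monoidal_transf C' D' F G u"
    "id_transf C D = id_transf C' D'" "vcomp_transf C D = vcomp_transf C' D'"
    "comp_mon_functor C D = comp_mon_functor C' D'" "hcomp_transf C D = hcomp_transf C' D'"
proof -
  note eqs = truncate_eqD [OF C] truncate_eqD [OF D]
  note cong = cat_truncate_cong [OF truncate_eqD(1) [OF C] truncate_eqD(1) [OF D]]
  have nat: "nat_iso (prod_cat C' C') D F G u = nat_iso (prod_cat C' C') D' F G u"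
for F G u
    by (rule cat_truncate_cong(6) [OF refl truncate_eqD(1) [OF D]])
  show "strong_multiplicative C D F = strong_multiplicative C' D' F"
    by (simp add: strong_multiplicative_def strong_multiplicative_axioms_def eqs cong nat
        cat_truncate_cong(8,10) [OF truncate_eqD(1) [OF C] truncate_eqD(1) [OF C]]
        comp_functor_def)
  show "monoidal_transf C D F G u = monoidal_transf C' D' F G u"
    by (simp add: monoidal_transf_def monoidal_transf_axioms_def multiplicative_transf_def
        multiplicative_transf_axioms_def eqs cong)
  show "id_transf C D = id_transf C' D'" "vcomp_transf C D = vcomp_transf C' D'"
    by (simp_all add: fun_eq_iff id_transf_def vcomp_transf_def eqs)
  show comp: "comp_mon_functor C D = comp_mon_functor C' D'"
    by (simp add: fun_eq_iff comp_mon_functor_def eqs cong)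
  show "hcomp_transf C D = hcomp_transf C' D'"
    by (simp add: fun_eq_iff hcomp_transf_def eqs comp)
qed

section \<open>The isomorphism of 2-categories\<close>

definition saavedra_of_lr :: "('o, 'm) lr_cat \<Rightarrow> ('o, 'm) saavedra_cat"
  where "saavedra_of_lr C = unital_cat.extend (unital_cat.truncate C) \<lparr>Alpha = Lam C (Unit C)\<rparr>"

definition lr_of_saavedra :: "('o, 'm) saavedra_cat \<Rightarrow> ('o, 'm) lr_cat"
  where "lr_of_saavedra C = unital_cat.extend (unital_cat.truncate C)
    \<lparr>Lam = left_constraint C (Unit C) (Alpha C), Rho = right_constraint C (Unit C) (Alpha C)\<rparr>"

lemma truncate_saavedra_of_lr: "unital_cat.truncate (saavedra_of_lr C) = unital_cat.truncate C"
  and Alpha_saavedra_of_lr: "Alpha (saavedra_of_lr C) = Lam C (Unit C)"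
  by (simp_all add: saavedra_of_lr_def unital_cat.defs)

lemma truncate_lr_of_saavedra: "unital_cat.truncate (lr_of_saavedra C) = unital_cat.truncate C"
  and Lam_lr_of_saavedra: "Lam (lr_of_saavedra C) = left_constraint C (Unit C) (Alpha C)"
  and Rho_lr_of_saavedra: "Rho (lr_of_saavedra C) = right_constraint C (Unit C) (Alpha C)"
  by (simp_all add: lr_of_saavedra_def unital_cat.defs)

lemmas Unit_saavedra_of_lr = truncate_eqD(9) [OF truncate_saavedra_of_lr]
lemmas Unit_lr_of_saavedra = truncate_eqD(9) [OF truncate_lr_of_saavedra]

text \<open>Agreement on objects comes from the LR axioms; the extensionality clauses of
  \<open>lr_monoidal\<close> upgrade it to equality of functions, as needed for equality of
  records.\<close>

lemma lr_constraints:
  assumes "lr_monoidal C"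
  shows "left_constraint C (Unit C) (Lam C (Unit C)) = Lam C"
    "right_constraint C (Unit C) (Lam C (Unit C)) = Rho C"
proof -
  interpret lr_unit C "Unit C" "Lam C" "Rho C" using assms by (simp add: lr_monoidal_def)
  show "left_constraint C (Unit C) (Lam C (Unit C)) = Lam C"
    by (rule extensionalityI [where A = "Obj C"])
      (use assms in \<open>simp_all add: left_constraint_of_lr lr_monoidal_def\<close>,
        simp add: left_constraint_def)
  show "right_constraint C (Unit C) (Lam C (Unit C)) = Rho C"
    by (rule extensionalityI [where A = "Obj C"])
      (use assms in \<open>simp_all add: right_constraint_of_lr lr_monoidal_def\<close>,
        simp add: right_constraint_def)
qed

lemma saavedra_monoidal_of_lr: "lr_monoidal C \<Longrightarrow> saavedra_monoidal (saavedra_of_lr C)"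
  by (auto simp: saavedra_monoidal_def lr_monoidal_def truncate_cong(2) [OF truncate_saavedra_of_lr]
      Unit_saavedra_of_lr Alpha_saavedra_of_lr intro: lr_unit.saavedra_unit_of_lr)

lemma lr_monoidal_of_saavedra: "saavedra_monoidal C \<Longrightarrow> lr_monoidal (lr_of_saavedra C)"
  by (simp add: saavedra_monoidal_def lr_monoidal_def truncate_cong(3) [OF truncate_lr_of_saavedra]
      truncate_eqD [OF truncate_lr_of_saavedra] Lam_lr_of_saavedra Rho_lr_of_saavedra
      saavedra_unit.lr_unit_of_saavedra)
    (simp add: left_constraint_def right_constraint_def)

lemma lr_of_saavedra_of_lr:
  assumes "lr_monoidal C"
  shows "lr_of_saavedra (saavedra_of_lr C) = C"
proof (rule lr_cat.equality)
  note eqs = truncate_eqD [OF truncate_lr_of_saavedra] truncate_eqD [OF truncate_saavedra_of_lr]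
  show "Lam (lr_of_saavedra (saavedra_of_lr C)) = Lam C"
    "Rho (lr_of_saavedra (saavedra_of_lr C)) = Rho C"
    by (simp_all add: Lam_lr_of_saavedra Rho_lr_of_saavedra Alpha_saavedra_of_lr eqs
        truncate_cong(4,5) [OF truncate_saavedra_of_lr] lr_constraints assms)
qed (simp_all add: truncate_eqD [OF truncate_lr_of_saavedra] truncate_eqD [OF truncate_saavedra_of_lr])

lemma saavedra_of_lr_of_saavedra:
  assumes "saavedra_monoidal C"
  shows "saavedra_of_lr (lr_of_saavedra C) = C"
proof (rule saavedra_cat.equality)
  interpret saavedra_unit C "Unit C" "Alpha C" using assms by (simp add: saavedra_monoidal_def)
  show "Alpha (saavedra_of_lr (lr_of_saavedra C)) = Alpha C"
    by (simp add: Alpha_saavedra_of_lr Lam_lr_of_saavedra Unit_lr_of_saavedra left_constraint_unit)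
qed (simp_all add: truncate_eqD [OF truncate_lr_of_saavedra] truncate_eqD [OF truncate_saavedra_of_lr])

section \<open>Comparison of 1-cells and of hom-categories\<close>

text \<open>By \<open>lr_constraints\<close>, \<open>Lam\<close> and \<open>Rho\<close> are the
  constraints generated by \<open>Lam C (Unit C)\<close>. Hence the Saavedra condition implies both
  LR equations, and conversely it follows from the equation for \<lambda> at the unit.\<close>

lemma strong_monoidal_iff:
  assumes C: "lr_monoidal C" and D: "lr_monoidal D"
  shows "saavedra_strong_monoidal (saavedra_of_lr C) (saavedra_of_lr D) F \<longleftrightarrow> lr_strong_monoidal C D F"
    (is "?sa \<longleftrightarrow> ?lr")
proof -
  interpret CU: lr_unit C "Unit C" "Lam C" "Rho C" using C by (simp add: lr_monoidal_def)
  interpret DU: lr_unit D "Unit D" "Lam D" "Rho D" using D by (simp add: lr_monoidal_def)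
  note units = CU.saavedra_unit_of_lr DU.saavedra_unit_of_lr
  note constraints = lr_constraints [OF C] lr_constraints [OF D]
  have sa: "?sa \<longleftrightarrow> strong_multiplicative C D F \<and> iso_arr D (Unit D) (obj_map F (Unit C)) (Phi0 F) \<and>
    Phi0 F \<cdot>\<^bsub>D\<^esub> Lam D (Unit D) = arr_map F (Lam C (Unit C)) \<cdot>\<^bsub>D\<^esub>
      (Phi2 F (Unit C, Unit C) \<cdot>\<^bsub>D\<^esub> (Phi0 F \<otimes>\<^bsub>D\<^esub> Phi0 F))"
    by (simp add: saavedra_strong_monoidal_def saavedra_strong_monoidal_axioms_def
        truncate_cong2(1) [OF truncate_saavedra_of_lr truncate_saavedra_of_lr]
        cat_truncate_cong(3) [OF truncate_eqD(1) [OF truncate_saavedra_of_lr]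
          truncate_eqD(1) [OF truncate_saavedra_of_lr]]
        truncate_eqD [OF truncate_saavedra_of_lr] Alpha_saavedra_of_lr)
  have unital: "unital_functor C D F"
    if "strong_multiplicative C D F" "iso_arr D (Unit D) (obj_map F (Unit C)) (Phi0 F)"
    using that by (simp add: unital_functorI CU.lr_unit_obj DU.lr_unit_obj
        CU.semimonoidal_axioms DU.semimonoidal_axioms)
  show ?thesis
  proof
    assume ?sa
    then have F: "strong_multiplicative C D F" "iso_arr D (Unit D) (obj_map F (Unit C)) (Phi0 F)"
      and unit: "Phi0 F \<cdot>\<^bsub>D\<^esub> Lam D (Unit D) = arr_map F (Lam C (Unit C)) \<cdot>\<^bsub>D\<^esub>
        (Phi2 F (Unit C, Unit C) \<cdot>\<^bsub>D\<^esub> (Phi0 F \<otimes>\<^bsub>D\<^esub> Phi0 F))"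
      by (simp_all add: sa)
    interpret unital_functor C D F using F by (rule unital)
    show ?lr
      using left_unit_of_saavedra [OF units unit] right_unit_of_saavedra [OF units unit] F
      by (simp add: lr_strong_monoidal_def lr_strong_monoidal_axioms_def constraints)
  next
    assume ?lr
    then interpret lr_strong_monoidal C D F .
    interpret unital_functor C D F
      by (rule unital) (simp_all add: strong_multiplicative_axioms Phi0_iso)
    show ?sa
      using saavedra_of_left_unit [OF units] Phi0_Lam [OF CU.lr_unit_obj]
      by (simp add: sa constraints strong_multiplicative_axioms unit_iso)
  qed
qed

text \<open>Identities and composites are transported from the Saavedra side through
  \<open>strong_monoidal_iff\<close>; \<open>id_mon_functor\<close> and
  \<open>comp_mon_functor\<close> see only the truncated categories.\<close>

lemma mon_functor_class_lr: "mon_functor_class {C :: ('o, 'm) lr_cat. lr_monoidal C} lr_strong_monoidal"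
proof (rule mon_functor_class.intro; unfold mem_Collect_eq)
  interpret sa: mon_functor_class "{C :: ('o, 'm) saavedra_cat. saavedra_monoidal C}" saavedra_strong_monoidal
    by (rule mon_functor_class_saavedra)
  note [simp] = saavedra_monoidal_of_lr
  show "lr_strong_monoidal C C (id_mon_functor C)" if "lr_monoidal C" for C :: "('o, 'm) lr_cat"
    using sa.P_id [of "saavedra_of_lr C"] that
    by (simp add: strong_monoidal_iff truncate_cong(6) [OF truncate_saavedra_of_lr])
  show "lr_strong_monoidal C E (comp_mon_functor C E G F)"
    if "lr_monoidal C" "lr_monoidal D" "lr_monoidal E" "lr_strong_monoidal C D F"
      "lr_strong_monoidal D E G" for C D E :: "('o, 'm) lr_cat" and F G
    using sa.P_comp [of "saavedra_of_lr C" "saavedra_of_lr D" "saavedra_of_lr E" F G] that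
    by (simp add: strong_monoidal_iff
        truncate_cong2(5) [OF truncate_saavedra_of_lr truncate_saavedra_of_lr])
  show "unital_functor C D F"
    if "lr_monoidal C" "lr_monoidal D" "lr_strong_monoidal C D F"
    for C D :: "('o, 'm) lr_cat" and F
  proof -
    interpret CU: lr_unit C "Unit C" "Lam C" "Rho C" using that by (simp add: lr_monoidal_def)
    interpret DU: lr_unit D "Unit D" "Lam D" "Rho D" using that by (simp add: lr_monoidal_def)
    interpret lr_strong_monoidal C D F by fact
    show ?thesis
      by (rule unital_functorI) (simp_all add: strong_multiplicative_axioms Phi0_iso
          CU.lr_unit_obj DU.lr_unit_obj CU.semimonoidal_axioms DU.semimonoidal_axioms)
  qed
qed

lemma mon_hom_cat_saavedra_of_lr:
  assumes "lr_monoidal C" "lr_monoidal D"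
  shows "mon_hom_cat saavedra_strong_monoidal (saavedra_of_lr C) (saavedra_of_lr D)
    = mon_hom_cat lr_strong_monoidal C D"
  by (simp add: mon_hom_cat_def strong_monoidal_iff assms truncate_eqD [OF truncate_saavedra_of_lr]
      truncate_cong2(2-4) [OF truncate_saavedra_of_lr truncate_saavedra_of_lr])

lemma mon_hom_cat_lr_of_saavedra:
  assumes "saavedra_monoidal C" "saavedra_monoidal D"
  shows "mon_hom_cat lr_strong_monoidal (lr_of_saavedra C) (lr_of_saavedra D)
    = mon_hom_cat saavedra_strong_monoidal C D"
  using mon_hom_cat_saavedra_of_lr [of "lr_of_saavedra C" "lr_of_saavedra D"] assms
  by (simp add: lr_monoidal_of_saavedra saavedra_of_lr_of_saavedra)

text \<open>Stated for a general \<open>h\<close> so that it serves in both directions. Since the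
  hom-categories are equal, identity maps are functors between them, and identity 1-cells and
  composites are preserved because they depend only on the truncations, which \<open>h\<close> does
  not change.\<close>

lemma two_functor_mon_two_cat:
  fixes h :: "('o, 'm, 'z) unital_cat_scheme \<Rightarrow> ('o, 'm, 'y) unital_cat_scheme"
  assumes X: "two_category (mon_two_cat S P)" and Y: "two_category (mon_two_cat S' P')"
    and h: "\<And>C. C \<in> S \<Longrightarrow> h C \<in> S'"
    and truncate: "\<And>C. unital_cat.truncate (h C) = unital_cat.truncate C"
    and hom: "\<And>C D. C \<in> S \<Longrightarrow> D \<in> S \<Longrightarrow> mon_hom_cat P' (h C) (h D) = mon_hom_cat P C D"
  shows "two_functor (mon_two_cat S P) (mon_two_cat S' P')
    \<lparr>map0 = h, map_hom = (\<lambda>C D. \<lparr>obj_map = id, arr_map = id\<rparr>)\<rparr>"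
proof (intro two_functor.intro two_functor_axioms.intro X Y)
  interpret X: two_category "mon_two_cat S P" by (rule X)
  show "cat_functor (HomCat (mon_two_cat S P) C D)
      (HomCat (mon_two_cat S' P')
        (map0 \<lparr>map0 = h, map_hom = \<lambda>C D. \<lparr>obj_map = id, arr_map = id\<rparr>\<rparr> C)
        (map0 \<lparr>map0 = h, map_hom = \<lambda>C D. \<lparr>obj_map = id, arr_map = id\<rparr>\<rparr> D))
      (map_hom \<lparr>map0 = h, map_hom = \<lambda>C D. \<lparr>obj_map = id, arr_map = id\<rparr>\<rparr> C D)"
    if "C \<in> Cell0 (mon_two_cat S P)" "D \<in> Cell0 (mon_two_cat S P)" for C D
  proof -
    interpret category "mon_hom_cat P C D" using X.HomCat_category [of C D] that by simp
    show ?thesis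
      \<comment> \<open>The field equations are flipped so that a hom-category is not unfolded
        before \<open>hom\<close> can identify source and target.\<close>
      using that by (auto intro!: cat_functorI category_axioms simp: hom simp flip: mon_hom_cat_simps)
  qed
qed (simp_all add: h truncate_cong(6) [OF truncate] truncate_cong2(5,6) [OF truncate truncate])

theorem proposition3p13:
  shows "\<exists>\<Phi>. two_cat_isomorphism
    (lr_two_cat :: (('o, 'm) lr_cat, ('o, 'm, 'o, 'm) mon_functor,
      ('o, 'm, 'o, 'm) transf) two_cat)
    (saavedra_two_cat :: (('o, 'm) saavedra_cat, ('o, 'm, 'o, 'm) mon_functor,
      ('o, 'm, 'o, 'm) transf) two_cat)
    \<Phi>"
proof -
  let ?H = "\<lambda>C D. \<lparr>obj_map = id, arr_map = id\<rparr>"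
  note lr = mon_functor_class.two_category_mon_two_cat [OF mon_functor_class_lr]
  note sa = mon_functor_class.two_category_mon_two_cat [OF mon_functor_class_saavedra]
  have "two_functor lr_two_cat saavedra_two_cat \<lparr>map0 = saavedra_of_lr, map_hom = ?H\<rparr>"
    unfolding lr_two_cat_def saavedra_two_cat_def
    by (rule two_functor_mon_two_cat [OF lr sa])
      (simp_all add: saavedra_monoidal_of_lr truncate_saavedra_of_lr mon_hom_cat_saavedra_of_lr)
  moreover have "two_functor saavedra_two_cat lr_two_cat \<lparr>map0 = lr_of_saavedra, map_hom = ?H\<rparr>"
    unfolding lr_two_cat_def saavedra_two_cat_def
    by (rule two_functor_mon_two_cat [OF sa lr])
      (simp_all add: lr_monoidal_of_saavedra truncate_lr_of_saavedra mon_hom_cat_lr_of_saavedra)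
  ultimately show ?thesis
    unfolding two_cat_isomorphism_def left_inverse_two_functor_def
    by (intro exI [of _ "\<lparr>map0 = saavedra_of_lr, map_hom = ?H\<rparr>"] conjI
        exI [of _ "\<lparr>map0 = lr_of_saavedra, map_hom = ?H\<rparr>"])
      (simp_all add: lr_two_cat_def saavedra_two_cat_def lr_of_saavedra_of_lr
        saavedra_of_lr_of_saavedra)
qed

end
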